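(* There is an absolute constant $C$ such that, for every integer $r\ge 2$, there is an $r$-Ramsey complete sequence $A$ of positive integers with $|A\cap[n]|\le Cr\log^{2}n$ for all positive integers $n$. Furthermore, there is an absolute constant $c>0$ such that, for every integer $r\ge 2$, no sequence $A$ of positive integers with $|A\cap[n]|\le cr\log^{2}n$ for all sufficiently large $n$ is $r$-Ramsey complete.
   Context: $[n]=\{1,\dots,n\}$ and $\log$ is the natural logarithm. For a sequence $A$ of positive integers, $\Sigma(A)$ denotes the set of all integers representable as a sum of distinct terms of $A$. A sequence $A$ of positive integers is $r$-Ramsey complete if, whenever $A$ is partitioned into $r$ classes $A_1,\dots,A_r$, every sufficiently large positive integer lies in $\bigcup_{i=1}^r\Sigma(A_i)$. *)

theory Defs
  imports Complex_Main
begin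

text \<open>A sequence of positive integers is modelled as an indexed family a :: nat => nat
  (terms a 0, a 1, ...; repetitions allowed). Sigma(A_I) for a set I of indices is the set of
  sums of distinct terms, i.e. sums over finite sets of indices in I.\<close>

definition subset_sums :: "(nat \<Rightarrow> nat) \<Rightarrow> nat set \<Rightarrow> nat set" where
  "subset_sums a I = {sum a F | F. finite F \<and> F \<subseteq> I}"

definition ramsey_complete :: "nat \<Rightarrow> (nat \<Rightarrow> nat) \<Rightarrow> bool" where
  "ramsey_complete r a \<longleftrightarrow>
     (\<forall>col :: nat \<Rightarrow> nat. (\<forall>i. col i < r) \<longrightarrow>
        (\<exists>N. \<forall>m\<ge>N. \<exists>j<r. m \<in> subset_sums a {i. col i = j}))"

text \<open>Counting function |A \<inter> [n]| (number of terms, with multiplicity, in {1..n}).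
  We additionally require finiteness where bounds are stated, since card of an infinite set is 0.\<close>

definition counting :: "(nat \<Rightarrow> nat) \<Rightarrow> nat \<Rightarrow> nat set" where
  "counting a n = {i. a i \<in> {1..n}}"

end

theory Submission
  imports Defs "HOL-Real_Asymp.Real_Asymp" "HOL-Library.FuncSet" "HOL-Library.Countable_Set"
begin

text \<open>
  \<^bold>\<open>Sparse sequences are not Ramsey complete.\<close> By averaging over dyadic scales there are
  arbitrarily large \<open>y = 2\<^sup>k\<close> with \<open>\<Sum>\<^sub>a min (a / y) (y / a) = O(c r log y)\<close>. Let \<open>x\<close> be a small multiple
  of \<open>y log y\<close>. Half of the colours share the terms up to \<open>y\<close> evenly, and then their total sums stay
  below \<open>x\<close>. The other half share the terms in \<open>(y, 2 x]\<close> evenly with respect to the weights \<open>y / a\<close>,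
  and then each has at most \<open>exp (2 x / y) \<Prod>(1 + exp (- a / y)) = y\<^bsup>O(c)\<^esup>\<close> subset sums up to \<open>2 x\<close>.
  So some number in \<open>(x, 2 x]\<close> is missed. Repeat this along a sparse sequence of scales.

  \<^bold>\<open>Construction.\<close> For each large \<open>k\<close> put \<open>O(r k)\<close> random terms \<open>1 + R u\<close> with \<open>2\<^sup>k \<le> u < 2\<^bsup>k+1\<^esup>\<close> into
  the sequence, where \<open>R\<close> depends on \<open>r\<close> only and removes the obstructions modulo small numbers. Add
  the terms of a fixed set of \<open>8 k\<close> indices one by one to the set \<open>S\<close> of their subset sums. A term
  \<open>b\<close> enlarges \<open>S\<close> by the number of \<open>s \<in> S\<close> with \<open>s + b \<notin> S\<close>, which is a subadditive even function of
  \<open>b\<close>. While \<open>S\<close> is small, almost every \<open>b\<close> enlarges it by half. Later, if a positive proportion of all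
  \<open>b\<close> hardly enlarge \<open>S\<close>, then by subadditivity all shifts up to a multiple of \<open>R 2\<^sup>k\<close> almost preserve
  \<open>S\<close>, so \<open>S\<close> fills most of a long interval. Hence this fails only with probability so
  small that a union bound over all index sets works. In each block some colour has \<open>240 k\<close> terms; two
  dense windows add up to an interval, which the remaining terms extend until it meets the interval
  of the next block.
\<close>

lemma ln_2_ge_half: "ln 2 \<ge> (1/2 :: real)"
  using exp_half_le2 by (subst ln_ge_iff) auto

section \<open>Sparse sequences\<close>

text \<open>Greedy assignment: each new element joins a class whose load is at most the average, so
  no class exceeds the average by more than one weight.\<close>

lemma balanced_partition:
  fixes w :: "'a \<Rightarrow> real" and h :: nat
  assumes "finite S" "h \<ge> 1" "\<And>i. i \<in> S \<Longrightarrow> 0 \<le> w i" "\<And>i. i \<in> S \<Longrightarrow> w i \<le> M" "0 \<le> M"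
  shows "\<exists>p :: 'a \<Rightarrow> nat. (\<forall>i. p i < h) \<and> (\<forall>j<h. sum w {i\<in>S. p i = j} \<le> sum w S / h + M)"
  using assms(1,3,4)
proof (induction S rule: finite_induct)
  case empty
  show ?case using assms by (intro exI[of _ "\<lambda>_. 0"]) auto
next
  case (insert x S)
  then obtain p where p: "\<And>i. p i < h" "\<And>j. j < h \<Longrightarrow> sum w {i\<in>S. p i = j} \<le> sum w S / h + M"
    by (metis insertCI)
  have tot: "(\<Sum>j<h. sum w {i\<in>S. p i = j}) = sum w S"
    using insert.hyps p(1) by (intro sum.group) auto
  obtain j0 where j0: "j0 < h" "sum w {i\<in>S. p i = j0} \<le> sum w S / h"
  proof (rule ccontr)
    assume "\<not> thesis"
    then have "\<And>j. j < h \<Longrightarrow> sum w {i\<in>S. p i = j} > sum w S / h" using that by force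
    then have "(\<Sum>j<h. sum w S / h) < (\<Sum>j<h. sum w {i\<in>S. p i = j})"
      using assms(2) by (intro sum_strict_mono) (auto simp: lessThan_empty_iff)
    then show False using tot assms(2) by auto
  qed
  define p' where "p' = p(x := j0)"
  have le: "sum w S / h \<le> sum w (insert x S) / h"
    using insert by (intro divide_right_mono) auto
  have "sum w {i\<in>insert x S. p' i = j} \<le> sum w (insert x S) / h + M" if "j < h" for j
  proof (cases "j = j0")
    case True
    then have "{i\<in>insert x S. p' i = j} = insert x {i\<in>S. p i = j0}"
      using insert.hyps by (auto simp: p'_def)
    then have "sum w {i\<in>insert x S. p' i = j} = w x + sum w {i\<in>S. p i = j0}"
      using insert.hyps by simp
    also have "\<dots> \<le> M + sum w S / h" using j0 insert.prems(2)[of x] by auto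
    finally show ?thesis using le by linarith
  next
    case False
    then have "{i\<in>insert x S. p' i = j} = {i\<in>S. p i = j}"
      using insert.hyps by (auto simp: p'_def)
    then show ?thesis using p(2)[OF that] le by simp
  qed
  moreover have "\<forall>i. p' i < h" using p j0 by (auto simp: p'_def)
  ultimately show ?case by blast
qed

text \<open>The summands decay geometrically on both sides of x. The bound serves to average over
  scales: a term of the sequence has total weight at most 4 over all dyadic scales.\<close>

lemma sum_min_ratio_pow2_le:
  fixes x :: real
  assumes "x > 0"
  shows "(\<Sum>k<K. min (x / 2^k) (2^k / x)) \<le> 4"
proof -
  have 1: "(\<Sum>k<K. if 2^k \<le> x then 2^k else 0) \<le> min (2*x) (2^K)" for K
    using assms by (induction K) (auto simp: min_def split: if_splits)
  \<comment> \<open>The powers beyond x. The correction \<open>2/2^K\<close> makes the induction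
    telescope, and \<open>max 0\<close> covers those K for which no power has passed x yet.\<close>
  have 2: "(\<Sum>k<K. if 2^k \<le> x then 0 else 1/2^k) \<le> max 0 (2/x - 2/2^K)" for K
  proof (induction K)
    case (Suc K)
    show ?case
    proof (cases "2^K \<le> x")
      case True
      have "2/x - 2/2^K \<le> 2/x - 2/2^Suc K" by (simp add: field_simps)
      then have "max 0 (2/x - 2/2^K) \<le> max 0 (2/x - 2/2^Suc K)" by linarith
      then show ?thesis using Suc True by simp
    next
      case False
      then have "2/2^K \<le> 2/x" using assms by (intro divide_left_mono) auto
      then have "max 0 (2/x - 2/2^K) + 1/2^K = 2/x - 2/2^Suc K"
        by (simp add: field_simps)
      then show ?thesis using Suc False by (simp add: max_def split: if_splits)
    qed
  qed auto
  have "(\<Sum>k<K. min (x / 2^k) (2^k / x))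
      \<le> (\<Sum>k<K. (if 2^k \<le> x then 2^k else 0) / x + x * (if 2^k \<le> x then 0 else 1/2^k))"
    by (intro sum_mono) (auto simp: min_def)
  also have "\<dots> = (\<Sum>k<K. if 2^k \<le> x then 2^k else 0) / x + x * (\<Sum>k<K. if 2^k \<le> x then 0 else 1/2^k)"
    by (simp add: sum.distrib sum_divide_distrib sum_distrib_left)
  also have "\<dots> \<le> (2*x)/x + x * (2/x)"
  proof (intro add_mono divide_right_mono mult_left_mono)
    show "(\<Sum>k<K. if 2^k \<le> x then 2^k else 0) \<le> 2*x" using 1[of K] by simp
    have "2/x - 2/2^K \<le> 2/x" by simp
    then show "(\<Sum>k<K. if 2^k \<le> x then 0 else 1/2^k) \<le> 2/x"
      using 2[of K] assms by (smt (verit) divide_nonneg_pos)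
  qed (use assms in auto)
  also have "\<dots> = 4" using assms by simp
  finally show ?thesis .
qed

text \<open>Exponential moment bound: \<open>exp (t * (X - sum a F))\<close> is at least 1 for every
  counted F, and its sum over all subsets factors into a product over G.\<close>

lemma card_small_sum_subsets_le:
  fixes a :: "'a \<Rightarrow> real"
  assumes "finite G" "t \<ge> 0"
  shows "real (card {F. F \<subseteq> G \<and> sum a F \<le> X}) \<le> exp (t * X) * (\<Prod>i\<in>G. 1 + exp (- t * a i))"
proof -
  let ?Q = "{F. F \<subseteq> G \<and> sum a F \<le> X}"
  have "real (card ?Q) = (\<Sum>F\<in>?Q. 1)" by simp
  also have "\<dots> \<le> (\<Sum>F\<in>?Q. exp (t * X) * exp (- t * sum a F))"
  proof (intro sum_mono)
    fix F assume "F \<in> ?Q"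
    then have "t * sum a F \<le> t * X" using assms by (auto intro: mult_left_mono)
    then show "1 \<le> exp (t * X) * exp (- t * sum a F)" by (simp flip: exp_add)
  qed
  also have "\<dots> \<le> (\<Sum>F\<in>Pow G. exp (t * X) * exp (- t * sum a F))"
    using assms by (intro sum_mono2) auto
  also have "\<dots> = exp (t * X) * (\<Sum>F\<in>Pow G. \<Prod>i\<in>F. exp (- t * a i))"
    unfolding sum_distrib_left
    using assms by (intro sum.cong) (auto simp: exp_sum[symmetric] sum_distrib_left finite_subset sum_negf)
  also have "(\<Sum>F\<in>Pow G. \<Prod>i\<in>F. exp (- t * a i)) = (\<Prod>i\<in>G. exp (- t * a i) + 1)"
    using prod_add[OF assms(1), of "\<lambda>i. exp (- t * a i)" "\<lambda>_. 1"] by simp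
  finally show ?thesis by (simp add: add.commute)
qed


text \<open>The colours are prescribed only on (Y, Y'], and m is missed however the other terms are
  coloured; this lets blocks at successive scales be put together. Terms above Y' exceed m, and the
  q terms up to Y add at most q Y to a sum and a factor 2^q to the number of sums.\<close>

lemma colouring_block_missing_sum:
  fixes a :: "nat \<Rightarrow> nat" and r Y :: nat
  assumes pos: "\<And>i. a i > 0" and fin: "\<And>n. finite (counting a n)" and r: "r \<ge> 2"
    and bnd: "\<forall>\<^sub>F n in sequentially. real (card (counting a n)) \<le> 1/2880 * real r * (ln (real n))\<^sup>2"
  shows "\<exists>Y' m col'. Y < m \<and> m \<le> Y' \<and> (\<forall>i. col' i < r) \<and>
    (\<forall>col. (\<forall>i. Y < a i \<longrightarrow> a i \<le> Y' \<longrightarrow> col i = col' i) \<longrightarrow>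
       (\<forall>j<r. m \<notin> subset_sums a {i. col i = j}))"
proof -
  define old where "old = counting a Y"
  define q where "q = card old"
  have "\<forall>\<^sub>F K in sequentially. real (card (counting a (4^K))) \<le> 1/2880 * real r * (ln (real (4^K)))\<^sup>2"
  proof (rule eventually_compose_filterlim[OF bnd], rule filterlim_at_top_mono)
    show "filterlim (\<lambda>K. K) at_top sequentially" by (rule filterlim_ident)
    show "\<forall>\<^sub>F K in sequentially. K \<le> 4 ^ K"
      by (intro always_eventually allI less_imp_le) (rule power_gt_expt, simp)
  qed
  moreover have "\<forall>\<^sub>F K in sequentially. real (q * Y + Y) < 2 powr (real K / 2 - 1)" by real_asymp
  moreover have "\<forall>\<^sub>F K in sequentially. real r * 2^q * exp (real K / 10 + 7) < 2 powr (real K / 2 - 1)"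
  proof -
    have "\<forall>\<^sub>F K in sequentially. c * exp (real K / 10 + 7) < exp (real K / 4 - 1/2)" if "c > 0" for c :: real
      using that by real_asymp
    then have "\<forall>\<^sub>F K in sequentially. real r * 2^q * exp (real K / 10 + 7) < exp (real K / 4 - 1/2)"
      using r by simp
    then show ?thesis using eventually_ge_at_top[of 2]
    proof eventually_elim
      case (elim K)
      \<comment> \<open>As ln 2 \<ge> 1/2, the right-hand side grows at least like exp (K/4), which
        beats exp (K/10).\<close>
      have "(real K / 2 - 1) * (1/2) \<le> (real K / 2 - 1) * ln 2"
        using elim(2) ln_2_ge_half by (intro mult_left_mono) auto
      then have "exp (real K / 4 - 1/2) \<le> 2 powr (real K / 2 - 1)"
        by (simp add: powr_def algebra_simps)
      then show ?case using elim(1) by linarith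
    qed
  qed
  moreover have "\<forall>\<^sub>F K in sequentially. real K / 15 + 6 < 2 ^ K" by real_asymp
  moreover have "\<forall>\<^sub>F K in sequentially. K \<ge> (1::nat)" by (rule eventually_ge_at_top)
  ultimately have "\<forall>\<^sub>F K in sequentially. real (card (counting a (4^K))) \<le> 1/2880 * real r * (ln (real (4^K)))\<^sup>2
      \<and> real (q * Y + Y) < 2 powr (real K / 2 - 1)
      \<and> real r * 2^q * exp (real K / 10 + 7) < 2 powr (real K / 2 - 1)
      \<and> real K / 15 + 6 < 2 ^ K \<and> K \<ge> 1"
    by (intro eventually_conj)
  \<comment> \<open>\<open>2 powr (K/2 - 1)\<close> is a lower bound for the scale y chosen below.
    \<open>K2\<close> makes the old terms negligible against y, \<open>K3\<close> keeps the number
    of sums available to all colours below y, and \<open>K4\<close> keeps 2 x within the counted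
    range \<open>4^K\<close>.\<close>
  then obtain K where K1: "real (card (counting a (4^K))) \<le> 1/2880 * real r * (ln (real (4^K)))\<^sup>2"
    and K2: "real (q * Y + Y) < 2 powr (real K / 2 - 1)"
    and K3: "real r * 2^q * exp (real K / 10 + 7) < 2 powr (real K / 2 - 1)"
    and K4: "real K / 15 + 6 < 2 ^ K" and K5: "K \<ge> 1"
    by (auto simp: eventually_sequentially)
  define E where "E = counting a (4^K)"
  have finE: "finite E" using fin by (simp add: E_def)
  have cardE: "real (card E) \<le> real r * (real K)\<^sup>2 / 720"
  proof -
    have "ln (real (4^K)) = real K * (2 * ln 2)"
      by (simp add: ln_realpow flip: ln_realpow[of 2 2, simplified])
    moreover have "0 \<le> real K * (2 * ln 2)" by simp
    moreover have "real K * (2 * ln 2) \<le> real K * 2"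
      using ln_2_less_1 by (intro mult_left_mono) auto
    ultimately have "(ln (real (4^K)))\<^sup>2 \<le> (real K * 2)\<^sup>2" by (metis power_mono)
    then have "1/2880 * real r * (ln (real (4^K)))\<^sup>2 \<le> 1/2880 * real r * (real K * 2)\<^sup>2"
      by (intro mult_left_mono) auto
    then show ?thesis using K1 by (simp add: E_def power_mult_distrib)
  qed
  define T where "T k = (\<Sum>i\<in>E. min (real (a i) / 2^k) (2^k / real (a i)))" for k :: nat
  \<comment> \<open>Averaging: the weights of all scales add up to at most 4 |E| \<le> r K^2 / 180,
    and at least K/2 scales lie in the upper half. Restricting to the upper half makes y at least
    about 2^(K/2).\<close>
  have "\<exists>k\<in>{K div 2..<K}. T k \<le> real r * real K / 90"
  proof (rule ccontr)
    assume "\<not> ?thesis"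
    then have big: "T k > real r * real K / 90" if "k \<in> {K div 2..<K}" for k using that by force
    have "real r * (real K)\<^sup>2 / 180 = (real K / 2) * (real r * real K / 90)"
      by (simp add: power2_eq_square)
    also have "\<dots> \<le> real (K - K div 2) * (real r * real K / 90)"
      by (intro mult_right_mono) auto
    also have "\<dots> = (\<Sum>k=K div 2..<K. real r * real K / 90)" by simp
    also have "\<dots> < (\<Sum>k=K div 2..<K. T k)"
      using K5 big by (intro sum_strict_mono) auto
    also have "\<dots> \<le> (\<Sum>k<K. T k)"
      by (intro sum_mono2) (auto simp: T_def intro!: sum_nonneg)
    also have "\<dots> = (\<Sum>i\<in>E. \<Sum>k<K. min (real (a i) / 2^k) (2^k / real (a i)))"
      unfolding T_def by (rule sum.swap)
    also have "\<dots> \<le> (\<Sum>i\<in>E. 4)"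
      using pos by (intro sum_mono sum_min_ratio_pow2_le) auto
    also have "\<dots> \<le> real r * (real K)\<^sup>2 / 180" using cardE by simp
    finally show False by simp
  qed
  then obtain k where k: "K div 2 \<le> k" "k < K" "T k \<le> real r * real K / 90" by auto
  define y :: nat where "y = 2^k"
  have ypos: "y > 0" by (simp add: y_def)
  have y_big: "2 powr (real K / 2 - 1) \<le> real y"
  proof -
    have "real K / 2 - 1 \<le> real k" using k(1) by linarith
    then have "2 powr (real K / 2 - 1) \<le> 2 powr real k" by simp
    then show ?thesis by (simp add: y_def powr_realpow)
  qed
  \<comment> \<open>x = M y has to bound the total of a colour with small terms: K/30 for an even
    share, 1 for the error in \<open>balanced_partition\<close>, and 1 for the old terms.\<close>
  define M where "M = K div 30 + 3"
  define x where "x = M * y"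
  have M_ge: "real M \<ge> real K / 30 + 2" and M_le: "2 * real M \<le> real K / 15 + 6"
    by (auto simp: M_def)
  have yx: "y \<le> x" by (simp add: x_def M_def)
  have x_le: "2 * x \<le> 4^K"
  proof -
    have "real (2 * M) \<le> real (2^K)" using M_le K4 by simp
    then have "2 * M \<le> 2^K" by (simp only: of_nat_le_iff)
    moreover have "y \<le> 2^K" using k by (simp add: y_def)
    ultimately have "2 * M * y \<le> 2^K * 2^K" by (rule mult_mono) auto
    also have "\<dots> = 4^K" by (simp flip: power_mult_distrib)
    finally show ?thesis by (simp add: x_def)
  qed
  have Yy: "q * Y + Y < y" using K2 y_big by linarith
  define S where "S = {i. Y < a i \<and> a i \<le> y}"
  define L where "L = {i. y < a i \<and> a i \<le> 2 * x}"
  have subs: "S \<subseteq> E" "L \<subseteq> E"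
    using x_le yx by (auto simp: S_def L_def E_def counting_def)
  have fins: "finite S" "finite L"
    using subs finE by (auto intro: finite_subset)
  \<comment> \<open>Both groups of colours have at least r/3 members, the worst case being r = 3. So
    an even share of the weight T k is at most K/30.\<close>
  define h where "h = r div 2"
  have h: "h \<ge> 1" "real h \<ge> real r / 3" "r - h \<ge> 1" "real (r - h) \<ge> real r / 3"
  proof -
    have "r \<le> 3 * h" "r \<le> 3 * (r - h)" using r by (auto simp: h_def)
    then have "real r \<le> real (3 * h)" "real r \<le> real (3 * (r - h))" by (simp_all only: of_nat_le_iff)
    then show "real h \<ge> real r / 3" "real (r - h) \<ge> real r / 3" by simp_all
    show "h \<ge> 1" "r - h \<ge> 1" using r by (auto simp: h_def)
  qed
  have share: "T k / real c \<le> real K / 30" if "real c \<ge> real r / 3" "c \<ge> 1" for c :: nat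
  proof -
    have "T k \<le> real K / 30 * (real r / 3)" using k(3) by (simp add: mult.commute)
    also have "\<dots> \<le> real K / 30 * real c" using that by (intro mult_left_mono) auto
    finally show ?thesis using that by (simp add: divide_le_eq)
  qed
  have "(\<Sum>i\<in>S. real (a i)) \<le> real y * T k"
  proof -
    have "(\<Sum>i\<in>S. real (a i)) = real y * (\<Sum>i\<in>S. real (a i) / real y)"
      using ypos by (simp add: sum_distrib_left)
    also have "(\<Sum>i\<in>S. real (a i) / real y) = (\<Sum>i\<in>S. min (real (a i) / 2^k) (2^k / real (a i)))"
    proof (intro sum.cong refl)
      fix i assume "i \<in> S"
      then have "real (a i) \<le> real y" by (simp add: S_def)
      then have "real (a i) \<le> 2^k" by (simp add: y_def)
      then have "real (a i) / 2^k \<le> 1" "1 \<le> 2^k / real (a i)" using pos[of i] by auto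
      then have "real (a i) / 2^k \<le> 2^k / real (a i)" by linarith
      then show "real (a i) / real y = min (real (a i) / 2^k) (2^k / real (a i))" by (simp only: min_absorb1) (simp add: y_def)
    qed
    also have "\<dots> \<le> T k" unfolding T_def
      using subs finE by (intro sum_mono2) auto
    finally show ?thesis by (simp add: mult_left_mono)
  qed
  then have "(\<Sum>i\<in>S. real (a i)) / real h \<le> real y * T k / real h"
    by (rule divide_right_mono) simp
  also have "\<dots> = real y * (T k / real h)" by simp
  also have "\<dots> \<le> real y * (real K / 30)"
    using share[OF h(2,1)] by (rule mult_left_mono) simp
  finally have sumS: "(\<Sum>i\<in>S. real (a i)) / real h \<le> real y * (real K / 30)" .
  have "(\<Sum>i\<in>L. real y / real (a i)) = (\<Sum>i\<in>L. min (real (a i) / 2^k) (2^k / real (a i)))"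
  proof (intro sum.cong refl)
    fix i assume "i \<in> L"
    then have "real (a i) > real y" by (simp add: L_def)
    then have "real (a i) > 2^k" by (simp add: y_def)
    then have "real (a i) / 2^k \<ge> 1" "2^k / real (a i) \<le> 1" using pos[of i] by auto
    then have "2^k / real (a i) \<le> real (a i) / 2^k" by linarith
    then show "real y / real (a i) = min (real (a i) / 2^k) (2^k / real (a i))" by (simp only: min_absorb2) (simp add: y_def)
  qed
  also have "\<dots> \<le> T k" unfolding T_def
    using subs finE by (intro sum_mono2) auto
  finally have "(\<Sum>i\<in>L. real y / real (a i)) / real (r - h) \<le> T k / real (r - h)"
    by (rule divide_right_mono) simp
  then have sumL: "(\<Sum>i\<in>L. real y / real (a i)) / real (r - h) \<le> real K / 30"
    by (rule order_trans[OF _ share[OF h(4,3)]])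
  obtain p where p: "\<And>i. p i < h"
    "\<And>j. j < h \<Longrightarrow> (\<Sum>i\<in>{i\<in>S. p i = j}. real (a i)) \<le> (\<Sum>i\<in>S. real (a i)) / real h + real y"
    using balanced_partition[OF fins(1) h(1), of "\<lambda>i. real (a i)" "real y"] unfolding S_def by force
  obtain p' where p': "\<And>i. p' i < r - h"
    "\<And>j. j < r - h \<Longrightarrow> (\<Sum>i\<in>{i\<in>L. p' i = j}. real y / real (a i)) \<le> (\<Sum>i\<in>L. real y / real (a i)) / real (r - h) + 1"
    using balanced_partition[OF fins(2) h(3), of "\<lambda>i. real y / real (a i)" 1] unfolding L_def by force
  define col' where "col' i = (if a i \<le> y then p i else h + p' i)" for i
  \<comment> \<open>The terms up to 2 x that colour h + j can contain: possibly any old term, since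
    those colours are not controlled, and its share of L.\<close>
  define G where "G j = old \<union> {i\<in>L. p' i = j}" for j
  define Z where "Z j = sum a ` {F. F \<subseteq> G j \<and> sum (\<lambda>i. real (a i)) F \<le> real (2 * x)}" for j
  have finold: "finite old" using fin by (simp add: old_def)
  have finG: "finite (G j)" for j using finold fins by (simp add: G_def)
  have old_L: "old \<inter> {i\<in>L. p' i = j} = {}" for j
    using Yy by (auto simp: old_def counting_def L_def)
  have finZ: "finite (Z j)" for j using finG by (simp add: Z_def)
  have cardZ: "real (card (Z j)) \<le> 2^q * exp (real K / 10 + 7)" if "j < r - h" for j
  proof -
    have "card (Z j) \<le> card {F. F \<subseteq> G j \<and> sum (\<lambda>i. real (a i)) F \<le> real (2 * x)}"
      unfolding Z_def using finG by (intro card_image_le) auto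
    then have "real (card (Z j)) \<le> real (card {F. F \<subseteq> G j \<and> sum (\<lambda>i. real (a i)) F \<le> real (2 * x)})"
      by simp
    also have "\<dots> \<le> exp (1 / real y * real (2 * x)) * (\<Prod>i\<in>G j. 1 + exp (- (1 / real y) * real (a i)))"
      by (rule card_small_sum_subsets_le[OF finG]) simp
    also have "1 / real y * real (2 * x) = 2 * real M" using ypos by (simp add: x_def)
    also have "(\<Prod>i\<in>G j. 1 + exp (- (1 / real y) * real (a i)))
      = (\<Prod>i\<in>old. 1 + exp (- (1 / real y) * real (a i))) * (\<Prod>i\<in>{i\<in>L. p' i = j}. 1 + exp (- (1 / real y) * real (a i)))"
      unfolding G_def using finold fins old_L by (intro prod.union_disjoint) auto
    \<comment> \<open>An old term costs a factor 2. For the others, with u = a i / y, use 1 + exp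
      (-u) \<le> exp (exp (-u)) \<le> exp (1/u), which holds because u \<le> exp u.\<close>
    also have "\<dots> \<le> (\<Prod>i\<in>old. 2) * (\<Prod>i\<in>{i\<in>L. p' i = j}. exp (real y / real (a i)))"
    proof (intro mult_mono prod_mono conjI)
      fix i
      let ?u = "real (a i) / real y"
      have u: "?u > 0" using pos[of i] ypos by simp
      have "?u \<le> exp ?u" using exp_ge_add_one_self[of ?u] by linarith
      then have "exp (- ?u) \<le> 1 / ?u"
        using le_imp_inverse_le[OF _ u] by (simp only: exp_minus inverse_eq_divide)
      moreover have "1 + exp (- ?u) \<le> exp (exp (- ?u))" by (rule exp_ge_add_one_self)
      ultimately have "1 + exp (- ?u) \<le> exp (1 / ?u)" by (meson exp_le_cancel_iff order_trans)
      then show "1 + exp (- (1 / real y) * real (a i)) \<le> exp (real y / real (a i))" by simp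
    qed (auto intro!: prod_nonneg add_nonneg_nonneg)
    also have "\<dots> = 2^q * exp (\<Sum>i\<in>{i\<in>L. p' i = j}. real y / real (a i))"
      using fins by (simp add: q_def exp_sum)
    also have "\<dots> \<le> 2^q * exp (real K / 30 + 1)"
      using order_trans[OF p'(2)[OF that] add_right_mono[OF sumL]] by simp
    also have "exp (2 * real M) * (2^q * exp (real K / 30 + 1)) = 2^q * exp (2 * real M + (real K / 30 + 1))"
      by (simp add: exp_add)
    also have "\<dots> \<le> 2^q * exp (real K / 10 + 7)"
      using M_le by simp
    finally show ?thesis by simp
  qed
  have "card (\<Union>j<r - h. Z j) < x"
  proof -
    have "real (card (\<Union>j<r - h. Z j)) \<le> real (\<Sum>j<r - h. card (Z j))"
      by (subst of_nat_le_iff) (rule card_UN_le, simp)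
    also have "\<dots> \<le> (\<Sum>j<r - h. 2^q * exp (real K / 10 + 7))"
      unfolding of_nat_sum using cardZ by (intro sum_mono) auto
    also have "\<dots> \<le> real r * (2^q * exp (real K / 10 + 7))" by (simp add: mult_right_mono)
    also have "\<dots> < real y" using K3 y_big by (simp add: mult.assoc)
    also have "\<dots> \<le> real x" using yx by simp
    finally show ?thesis by simp
  qed
  \<comment> \<open>The interval holds x integers, more than the sums available to the second group
    of colours.\<close>
  then have "\<not> {x<..2 * x} \<subseteq> (\<Union>j<r - h. Z j)"
    using card_mono[of "\<Union>j<r - h. Z j" "{x<..2 * x}"] finZ by auto
  then obtain m where m: "x < m" "m \<le> 2 * x" "\<And>j. j < r - h \<Longrightarrow> m \<notin> Z j"
    by (auto simp: subset_iff)
  show ?thesis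
  proof (intro exI conjI allI impI notI)
    show "Y < m" "m \<le> 2 * x" using m Yy yx by linarith+
    show "col' i < r" for i using p(1)[of i] p'(1)[of i] h by (auto simp: col'_def h_def)
  next
    fix col j assume agree: "\<forall>i. Y < a i \<longrightarrow> a i \<le> 2 * x \<longrightarrow> col i = col' i"
      and j: "j < r" and "m \<in> subset_sums a {i. col i = j}"
    then obtain F where F: "finite F" "F \<subseteq> {i. col i = j}" "m = sum a F" by (auto simp: subset_sums_def)
    have le: "a i \<le> 2 * x" if "i \<in> F" for i
      using member_le_sum[of i F a] that F m by simp
    show False
    proof (cases "j < h")
      \<comment> \<open>A colour of the first group has too small a total: old terms, even share and
        balancing error add up to at most x < m.\<close>
      case True
      have "i \<in> old \<union> {i\<in>S. p i = j}" if "i \<in> F" for i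
      proof (cases "a i \<le> Y")
        case False
        then have "col' i = j" using agree le[OF that] that F(2) by auto
        then show ?thesis using True False by (auto simp: col'_def S_def split: if_splits)
      qed (use pos[of i] in \<open>auto simp: old_def counting_def\<close>)
      then have "sum a F \<le> sum a (old \<union> {i\<in>S. p i = j})"
        using finold fins by (intro sum_mono2) auto
      also have "\<dots> \<le> sum a old + sum a {i\<in>S. p i = j}"
        using sum.union_inter[of old "{i\<in>S. p i = j}" a] finold fins by simp
      finally have total: "real m \<le> real (sum a old) + (\<Sum>i\<in>{i\<in>S. p i = j}. real (a i))"
        using F(3) by (simp flip: of_nat_add of_nat_sum)
      have "sum a old \<le> q * Y"
        using sum_bounded_above[of old a Y] by (auto simp: q_def old_def counting_def)
      then have old_sum: "sum a old \<le> y" using Yy by linarith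
      note total
      also have "real (sum a old) \<le> real y" using old_sum by (simp only: of_nat_le_iff)
      also have "(\<Sum>i\<in>{i\<in>S. p i = j}. real (a i)) \<le> real y * (real K / 30) + real y"
        by (rule order_trans[OF p(2)[OF True] add_right_mono[OF sumS]])
      also have "real y + (real y * (real K / 30) + real y) = real y * (real K / 30 + 2)"
        by (simp add: algebra_simps)
      also have "\<dots> \<le> real y * real M" using M_ge by (intro mult_left_mono) auto
      also have "\<dots> = real x" by (simp add: x_def)
      finally show False using m(1) by simp
    next
      case False
      have "i \<in> G (j - h)" if "i \<in> F" for i
      proof (cases "a i \<le> Y")
        case False': False
        then have "col' i = j" using agree le[OF that] that F(2) by auto
        then show ?thesis using False p(1)[of i] le[OF that] by (auto simp: col'_def G_def L_def split: if_splits)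
      qed (use pos[of i] in \<open>auto simp: old_def counting_def G_def\<close>)
      moreover have "(\<Sum>i\<in>F. real (a i)) \<le> real (2 * x)"
        using F(3) m(2) by (simp flip: of_nat_sum)
      ultimately have "m \<in> Z (j - h)" using F(3) by (auto simp: Z_def)
      then show False using m(3)[of "j - h"] j False by auto
    qed
  qed
qed

text \<open>The local colourings for the blocks (Y n, Y (n + 1)] are glued. Every colour then misses
  each \<open>m (Y n)\<close>, and these numbers are unbounded.\<close>

lemma sparse_not_ramsey_complete:
  fixes a :: "nat \<Rightarrow> nat" and r :: nat
  assumes pos: "\<And>i. a i > 0" and fin: "\<And>n. finite (counting a n)" and r: "r \<ge> 2"
    and bnd: "\<forall>\<^sub>F n in sequentially. real (card (counting a n)) \<le> 1/2880 * real r * (ln (real n))\<^sup>2"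
  shows "\<not> ramsey_complete r a"
proof
  assume rc: "ramsey_complete r a"
  obtain g m c where st: "\<And>Y. Y < m Y" "\<And>Y. m Y \<le> g Y" "\<And>Y i. c Y i < r"
    "\<And>Y col j. (\<And>i. Y < a i \<Longrightarrow> a i \<le> g Y \<Longrightarrow> col i = c Y i) \<Longrightarrow> j < r \<Longrightarrow> m Y \<notin> subset_sums a {i. col i = j}"
    using colouring_block_missing_sum[OF pos fin r bnd] by metis
  define Y where "Y n = (g ^^ n) 0" for n
  have YS: "Y (Suc n) = g (Y n)" for n by (simp add: Y_def)
  have sm: "strict_mono Y" using st(1,2) YS by (metis less_le_trans strict_mono_Suc_iff)
  define lev where "lev i = (LEAST n. a i \<le> Y (Suc n))" for i
  have lev: "lev i = n" if "Y n < a i" "a i \<le> Y (Suc n)" for i n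
    unfolding lev_def
  proof (rule Least_equality)
    fix l assume "a i \<le> Y (Suc l)"
    then have "Y n < Y (Suc l)" using that by simp
    then show "n \<le> l" using sm by (simp add: strict_mono_less)
  qed (use that in simp)
  define col where "col i = c (Y (lev i)) i" for i
  have "\<forall>i. col i < r" using st(3) by (simp add: col_def)
  then obtain N where N: "\<And>x. x \<ge> N \<Longrightarrow> \<exists>j<r. x \<in> subset_sums a {i. col i = j}"
    using rc unfolding ramsey_complete_def by metis
  have "m (Y N) \<ge> N" using st(1)[of "Y N"] strict_mono_imp_increasing[OF sm, of N] by linarith
  then obtain j where "j < r" "m (Y N) \<in> subset_sums a {i. col i = j}" using N by blast
  then show False using st(4)[of "Y N" col j] lev YS by (auto simp: col_def)
qed

section \<open>Shifts and dense windows\<close>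

text \<open>For finite S this is half the size of the symmetric difference of S and its translate by
  b. By \<open>card_Un_shift\<close> it counts the new sums that a term b creates. Integers permit
  negative shifts.\<close>

definition shift_defect :: "int set \<Rightarrow> int \<Rightarrow> nat" where
  "shift_defect S b = card {s \<in> S. s + b \<notin> S}"

lemma shift_defect_0 [simp]: "shift_defect S 0 = 0"
  by (simp add: shift_defect_def)

lemma card_shift_defect:
  assumes "finite S"
  shows "card {s \<in> S. s + b \<in> S} + shift_defect S b = card S"
proof -
  have "card ({s \<in> S. s + b \<in> S} \<union> {s \<in> S. s + b \<notin> S}) = card {s \<in> S. s + b \<in> S} + shift_defect S b"
    unfolding shift_defect_def using assms by (intro card_Un_disjoint) auto
  moreover have "{s \<in> S. s + b \<in> S} \<union> {s \<in> S. s + b \<notin> S} = S" by auto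
  ultimately show ?thesis by simp
qed

text \<open>An element s that leaves S under b + c either leaves it under b, or s + b lies in S and
  leaves it under c.\<close>

lemma shift_defect_add:
  assumes "finite S"
  shows "shift_defect S (b + c) \<le> shift_defect S b + shift_defect S c"
proof -
  have "{s \<in> S. s + (b + c) \<notin> S} \<subseteq> {s \<in> S. s + b \<notin> S} \<union> {s. s + b \<in> {s \<in> S. s + c \<notin> S}}"
    by (auto simp: add.assoc)
  moreover have "{s. s + b \<in> {s \<in> S. s + c \<notin> S}} = (\<lambda>s. s - b) ` {s \<in> S. s + c \<notin> S}"
    by (force simp: image_iff)
  ultimately have "shift_defect S (b + c) \<le> card ({s \<in> S. s + b \<notin> S} \<union> (\<lambda>s. s - b) ` {s \<in> S. s + c \<notin> S})"
    unfolding shift_defect_def using assms by (intro card_mono) auto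
  also have "\<dots> \<le> shift_defect S b + card ((\<lambda>s. s - b) ` {s \<in> S. s + c \<notin> S})"
    unfolding shift_defect_def by (rule card_Un_le)
  also have "\<dots> \<le> shift_defect S b + shift_defect S c"
    unfolding shift_defect_def using assms by (simp add: card_image_le)
  finally show ?thesis .
qed

text \<open>The shift by b maps the elements that stay in S under b bijectively to those that stay
  under -b.\<close>

lemma shift_defect_minus:
  assumes "finite S"
  shows "shift_defect S (- b) = shift_defect S b"
proof -
  have "{s \<in> S. s + b \<in> S} = (\<lambda>s. s - b) ` {s \<in> S. s + - b \<in> S}"
    by (force simp: image_iff intro!: bexI[of _ "_ + b"])
  then have "card {s \<in> S. s + b \<in> S} = card {s \<in> S. s + - b \<in> S}"
    by (simp add: card_image inj_on_def)
  then show ?thesis using card_shift_defect[OF assms, of b] card_shift_defect[OF assms, of "-b"] by simp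
qed

lemma card_Un_shift:
  assumes "finite S"
  shows "card (S \<union> (\<lambda>s. s + b) ` S) = card S + shift_defect S b"
proof -
  have "S \<union> (\<lambda>s. s + b) ` S = S \<union> (\<lambda>s. s + b) ` {s \<in> S. s + b \<notin> S}" by auto
  moreover have "card (S \<union> (\<lambda>s. s + b) ` {s \<in> S. s + b \<notin> S})
      = card S + card ((\<lambda>s. s + b) ` {s \<in> S. s + b \<notin> S})"
    using assms by (intro card_Un_disjoint) auto
  ultimately show ?thesis by (simp add: card_image inj_on_def shift_defect_def)
qed

text \<open>Double counting: each such b yields more than |S|/2 pairs (s, s + b) in the square of S,
  and a pair determines b. So while S is small, all but few terms enlarge it by half.\<close>

lemma card_small_shift_defect_le:
  assumes "finite S" "finite X"
  shows "card {b \<in> X. 2 * shift_defect S b < card S} \<le> 2 * card S"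
proof (cases "S = {}")
  case False
  let ?H = "{b \<in> X. 2 * shift_defect S b < card S}"
  have "card ?H * card S = (\<Sum>b\<in>?H. card S)" by simp
  also have "\<dots> \<le> (\<Sum>b\<in>?H. 2 * card {s \<in> S. s + b \<in> S})"
  proof (intro sum_mono)
    fix b assume "b \<in> ?H"
    then show "card S \<le> 2 * card {s \<in> S. s + b \<in> S}"
      using card_shift_defect[OF assms(1), of b] by simp
  qed
  also have "\<dots> = 2 * (\<Sum>b\<in>?H. card {s \<in> S. s + b \<in> S})" by (simp add: sum_distrib_left)
  also have "(\<Sum>b\<in>?H. card {s \<in> S. s + b \<in> S}) = card (SIGMA b:?H. {s \<in> S. s + b \<in> S})"
    using assms by (simp)
  also have "\<dots> \<le> card (S \<times> S)"
  proof (rule card_inj_on_le)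
    show "inj_on (\<lambda>(b, s). (s, s + b)) (SIGMA b:?H. {s \<in> S. s + b \<in> S})"
      by (auto simp: inj_on_def)
  qed (use assms in auto)
  also have "2 * card (S \<times> S) = 2 * card S * card S" by (simp add: card_cartesian_product)
  finally have "card ?H * card S \<le> 2 * card S * card S" by simp
  moreover have "card S > 0" using False assms by (simp add: card_gt_0_iff)
  ultimately show ?thesis by simp
qed auto

text \<open>The density 7/8 leaves room in the pigeonhole argument of
  \<open>dense_windows_add_interval\<close>, which needs a density above 3/4.\<close>

definition dense_window :: "nat \<Rightarrow> int set \<Rightarrow> bool" where
  "dense_window W S \<longleftrightarrow> (\<exists>s. 7 * W \<le> 8 * card (S \<inter> {s<..s + int W}))"

lemma dense_window_mono:
  assumes "dense_window W S" "S \<subseteq> T"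
  shows "dense_window W T"
proof -
  obtain s where s: "7 * W \<le> 8 * card (S \<inter> {s<..s + int W})" using assms by (auto simp: dense_window_def)
  have "card (S \<inter> {s<..s + int W}) \<le> card (T \<inter> {s<..s + int W})"
    using assms by (intro card_mono) auto
  then show ?thesis using s by (auto simp: dense_window_def intro!: exI[of _ s])
qed

text \<open>Count the pairs (s, x) with s + x \<in> S in two ways: each shift x keeps at least 7/8
  of S, so on average over s the window after s has density at least 7/8.\<close>

lemma dense_window_if_shift_defect_small:
  assumes "finite S" "S \<noteq> {}" "\<And>x. x \<in> {1..int W} \<Longrightarrow> 8 * shift_defect S x \<le> card S"
  shows "dense_window W S"
proof (rule ccontr)
  assume nd: "\<not> dense_window W S"
  have eq: "card {x \<in> {1..int W}. s + x \<in> S} = card (S \<inter> {s<..s + int W})" for s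
    by (intro bij_betw_same_card[of "\<lambda>x. s + x"] bij_betwI[where g = "\<lambda>x. x - s"]) auto
  have "7 * card S * W = (\<Sum>x\<in>{1..int W}. 7 * card S)" by simp
  also have "\<dots> \<le> (\<Sum>x\<in>{1..int W}. 8 * card {s \<in> S. s + x \<in> S})"
  proof (intro sum_mono)
    fix x assume "x \<in> {1..int W}"
    then show "7 * card S \<le> 8 * card {s \<in> S. s + x \<in> S}"
      using assms(3)[of x] card_shift_defect[OF assms(1), of x] by linarith
  qed
  also have "\<dots> = 8 * (\<Sum>x\<in>{1..int W}. \<Sum>s\<in>S. of_bool (s + x \<in> S))"
    using assms(1) by (simp add: sum_distrib_left Int_def)
  also have "\<dots> = 8 * (\<Sum>s\<in>S. \<Sum>x\<in>{1..int W}. of_bool (s + x \<in> S))"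
    by (subst sum.swap) simp
  also have "\<dots> = (\<Sum>s\<in>S. 8 * card (S \<inter> {s<..s + int W}))"
    unfolding eq[symmetric] by (simp add: sum_distrib_left Int_def)
  also have "\<dots> < (\<Sum>s\<in>S. 7 * W)"
    using nd assms by (intro sum_strict_mono) (auto simp: dense_window_def not_le)
  finally show False by simp
qed

section \<open>Signed sums of many terms cover an interval of shifts\<close>

text \<open>The ball of radius k around 0 in the word metric of T and -T; the option t = 0 makes the
  balls nested.\<close>

primrec signed_sums :: "int set \<Rightarrow> nat \<Rightarrow> int set" where
  "signed_sums T 0 = {0}"
| "signed_sums T (Suc k) = {v + t | v t. v \<in> signed_sums T k \<and> (t = 0 \<or> t \<in> T \<or> - t \<in> T)}"

lemma signed_sums_Suc_mono: "signed_sums T k \<subseteq> signed_sums T (Suc k)"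
  by force

lemma signed_sums_mono: "k \<le> l \<Longrightarrow> signed_sums T k \<subseteq> signed_sums T l"
  using lift_Suc_mono_le[of "signed_sums T"] signed_sums_Suc_mono by blast

lemma signed_sums_step:
  assumes "v \<in> signed_sums T k" "t \<in> T \<or> - t \<in> T"
  shows "v + t \<in> signed_sums T (Suc k)"
  using assms by auto

lemma signed_sums_add_mult:
  assumes "v \<in> signed_sums T k" "t \<in> T"
  shows "v + j * t \<in> signed_sums T (k + nat \<bar>j\<bar>)"
proof -
  have 1: "v + int n * t \<in> signed_sums T (k + n)" for n
  proof (induction n)
    case (Suc n)
    then show ?case using signed_sums_step[OF Suc, of t] assms by (simp add: algebra_simps)
  qed (use assms in simp)
  have 2: "v - int n * t \<in> signed_sums T (k + n)" for n
  proof (induction n)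
    case (Suc n)
    then show ?case using signed_sums_step[OF Suc, of "-t"] assms by (simp add: algebra_simps)
  qed (use assms in simp)
  show ?thesis using 1[of "nat \<bar>j\<bar>"] 2[of "nat \<bar>j\<bar>"] by (cases "j \<ge> 0") auto
qed

lemma signed_sums_abs_le:
  assumes "\<And>t. t \<in> T \<Longrightarrow> \<bar>t\<bar> \<le> B" "0 \<le> B"
  shows "v \<in> signed_sums T k \<Longrightarrow> \<bar>v\<bar> \<le> int k * B"
proof (induction k arbitrary: v)
  case (Suc k)
  then obtain u t where ut: "v = u + t" "u \<in> signed_sums T k" "t = 0 \<or> t \<in> T \<or> - t \<in> T" by auto
  have "\<bar>t\<bar> \<le> B" using ut(3) assms(1)[of t] assms(1)[of "-t"] assms(2) by auto
  then show ?case using Suc.IH[OF ut(2)] ut(1) by (simp add: algebra_simps)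
qed auto

text \<open>Subadditivity and evenness of the defect carry a bound from T to the whole ball, at cost
  \<delta> per step.\<close>

lemma shift_defect_signed_sums_le:
  assumes "finite S" "\<And>t. t \<in> T \<Longrightarrow> real (shift_defect S t) \<le> \<delta>" "0 \<le> \<delta>"
  shows "v \<in> signed_sums T k \<Longrightarrow> real (shift_defect S v) \<le> k * \<delta>"
proof (induction k arbitrary: v)
  case (Suc k)
  then obtain u t where ut: "v = u + t" "u \<in> signed_sums T k" "t = 0 \<or> t \<in> T \<or> - t \<in> T" by auto
  have "real (shift_defect S t) \<le> \<delta>"
    using ut(3) assms(2)[of t] assms(2)[of "-t"] assms(3) shift_defect_minus[OF assms(1)] by auto
  then show ?case using Suc.IH[OF ut(2)] ut(1) shift_defect_add[OF assms(1), of u t]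
    by (simp add: algebra_simps)
qed auto

text \<open>Bezout: 1 is an integer combination of x and y, so these shifts lead from 0 to every
  residue.\<close>

lemma closed_under_shifts_mod:
  fixes C :: "int set" and w x y :: int
  assumes "w > 0" "coprime x y" "0 \<in> C"
    and x: "\<And>c. c mod w \<in> C \<Longrightarrow> (c + x) mod w \<in> C" "\<And>c. c mod w \<in> C \<Longrightarrow> (c - x) mod w \<in> C"
    and y: "\<And>c. c mod w \<in> C \<Longrightarrow> (c + y) mod w \<in> C" "\<And>c. c mod w \<in> C \<Longrightarrow> (c - y) mod w \<in> C"
  shows "{0..<w} \<subseteq> C"
proof
  have mult: "(c + k * t) mod w \<in> C" if "c mod w \<in> C"
    and t: "\<And>c. c mod w \<in> C \<Longrightarrow> (c + t) mod w \<in> C" "\<And>c. c mod w \<in> C \<Longrightarrow> (c - t) mod w \<in> C"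
    for c k t
  proof (induction k rule: int_induct[where k = 0])
    case (step1 i)
    then show ?case using t(1)[of "c + i * t"] by (simp add: algebra_simps)
  next
    case (step2 i)
    then show ?case using t(2)[of "c + i * t"] by (simp add: algebra_simps)
  qed (use that in simp)
  fix z assume z: "z \<in> {0..<w}"
  obtain u v where uv: "u * x + v * y = 1" using bezout_int[of x y] assms(2) by auto
  have "(0 + (z * u) * x) mod w \<in> C" using assms(1,3) x by (intro mult) auto
  then have "((0 + (z * u) * x) + (z * v) * y) mod w \<in> C" using y by (rule mult)
  moreover have "(0 + (z * u) * x) + (z * v) * y = z"
    using uv by (metis add_0 distrib_left mult.assoc mult.right_neutral)
  ultimately show "z \<in> C" using z by simp
qed

text \<open>Growth of balls in the Cayley graph of the residues mod w. If some residue z has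
  distance exactly 3 i + 2 from 0, then the residues z + t have distance between 3 i + 1 and 3 i +
  3, so three more steps gain card T new residues. Otherwise the ball of radius 3 i + 1 is closed
  under all shifts from T, and coprimality makes it everything.\<close>

lemma signed_sums_residues_grow:
  fixes T :: "int set" and w x y :: int
  assumes w: "w > 0" and inj: "inj_on (\<lambda>t. t mod w) T" and cop: "coprime x y"
    and x: "x \<in> T" and y: "u \<in> T" "v \<in> T" "y = u - v"
  defines "C \<equiv> \<lambda>j. (\<lambda>v. v mod w) ` signed_sums T j"
  shows "{0..<w} \<subseteq> C (3 * i) \<or> i * card T \<le> card (C (3 * i))"
proof (induction i)
  case (Suc i)
  have mono: "C j \<subseteq> C l" if "j \<le> l" for j l
    using signed_sums_mono[OF that] by (auto simp: C_def)
  have finC: "finite (C j)" for j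
  proof (rule finite_subset)
    show "C j \<subseteq> {0..<w}" using w unfolding C_def by (intro image_subsetI) simp
  qed simp
  have Cadd: "(c + t) mod w \<in> C (Suc j)" if ct: "c mod w \<in> C j" "t \<in> T \<or> - t \<in> T" for c t j
  proof -
    obtain v where "v \<in> signed_sums T j" "c mod w = v mod w" using ct(1) by (auto simp: C_def)
    then have "(c + t) mod w = (v + t) mod w" "v + t \<in> signed_sums T (Suc j)"
      using signed_sums_step[OF _ ct(2)] by (auto intro: mod_add_cong)
    then show ?thesis unfolding C_def by blast
  qed
  show ?case
  proof (cases "C (3 * i + 2) \<subseteq> C (3 * i + 1)")
    case True
    have st: "(c + t) mod w \<in> C (3 * i + 1)" if "c mod w \<in> C (3 * i + 1)" "t \<in> T \<or> - t \<in> T" for c t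
      using Cadd[OF that] True by (auto simp: numeral_2_eq_2)
    have "0 \<in> signed_sums T j" for j using signed_sums_mono[of 0 j T] by auto
    then have "0 \<in> C (3 * i + 1)" by (force simp: C_def)
    then have "{0..<w} \<subseteq> C (3 * i + 1)"
    proof (rule closed_under_shifts_mod[OF w cop])
      fix c assume c: "c mod w \<in> C (3 * i + 1)"
      show "(c + x) mod w \<in> C (3 * i + 1)" using st[OF c, of x] x by auto
      show "(c - x) mod w \<in> C (3 * i + 1)" using st[OF c, of "-x"] x by auto
      \<comment> \<open>The shift by y = u - v is made in two steps, each of which stays in the
        closed ball.\<close>
      show "(c + y) mod w \<in> C (3 * i + 1)" using st[OF st[OF c, of u], of "-v"] y by (auto simp: add_diff_eq)
      show "(c - y) mod w \<in> C (3 * i + 1)" using st[OF st[OF c, of "-u"], of v] y by (auto simp: algebra_simps)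
    qed
    then show ?thesis using mono[of "3 * i + 1" "3 * Suc i"] by auto
  next
    case False
    then obtain z where z: "z \<in> C (3 * i + 2)" "z \<notin> C (3 * i + 1)" by auto
    let ?D = "(\<lambda>t. (z + t) mod w) ` T"
    have zw: "z mod w = z" using z by (auto simp: C_def)
    have sub: "?D \<subseteq> C (3 * Suc i)"
      using Cadd[of z "3 * i + 2"] z zw by (auto simp: eval_nat_numeral)
    have disj: "C (3 * i) \<inter> ?D = {}"
    proof (rule ccontr)
      assume "C (3 * i) \<inter> ?D \<noteq> {}"
      then obtain t where "t \<in> T" "(z + t) mod w \<in> C (3 * i)" by auto
      then have "(z + t + - t) mod w \<in> C (3 * i + 1)" using Cadd[of "z + t" "3 * i" "-t"] by simp
      then show False using z zw by simp
    qed
    have "inj_on (\<lambda>t. (z + t) mod w) T"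
    proof (rule inj_onI)
      fix s t assume st: "s \<in> T" "t \<in> T" "(z + s) mod w = (z + t) mod w"
      then have "(z + s - z) mod w = (z + t - z) mod w" by (intro mod_diff_cong) auto
      then show "s = t" using inj st by (auto simp: inj_on_def)
    qed
    then have "card (C (3 * i)) + card T = card (C (3 * i) \<union> ?D)"
      using disj finC sub by (subst card_Un_disjoint) (auto simp: card_image intro: finite_subset)
    also have "\<dots> \<le> card (C (3 * Suc i))"
      using sub mono[of "3 * i" "3 * Suc i"] finC by (intro card_mono) auto
    finally show ?thesis using Suc mono[of "3 * i" "3 * Suc i"] by auto
  qed
qed auto

text \<open>The choice of \<open>R\<close> makes the terms coprime to every \<open>e \<le> g\<close>, and a set of
  more than \<open>y / g\<close> values of \<open>u\<close> contains two whose difference is such an \<open>e\<close>. This rules out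
  that all the terms \<open>1 + R u\<close> lie in a proper subgroup of the integers.\<close>

lemma signed_sums_cover_interval:
  fixes g R y :: nat and U :: "nat set"
  assumes g: "g \<ge> 1" and R: "R = fact g" and y: "y \<ge> g * (g + 1)"
    and U: "U \<subseteq> {y..<2 * y}" "y < g * card U"
  shows "{0..int (8 * R * y)} \<subseteq> signed_sums ((\<lambda>u. 1 + int R * int u) ` U) (27 * R * g + 17)"
proof
  let ?b = "\<lambda>u. 1 + int R * int u"
  let ?T = "?b ` U"
  have Rpos: "R \<ge> 1" using R by (simp add: fact_ge_1)
  have ypos: "y \<ge> 1" using y g by (metis One_nat_def Suc_leI add_gr_0 le_trans mult_pos_pos zero_less_one less_eq_Suc_le)
  have cardT: "card ?T = card U" using Rpos by (intro card_image) (auto simp: inj_on_def)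
  \<comment> \<open>Pigeonhole: pieces of length g + 1 cut the range of U into at most y/(g + 1) + 1
    parts, fewer than card U because y \<ge> g (g + 1).\<close>
  obtain u v where uv: "u \<in> U" "v \<in> U" "v < u" "u - v \<le> g"
  proof -
    let ?f = "\<lambda>u. (u - y) div (g + 1)"
    have "?f ` U \<subseteq> {..y div (g + 1)}"
      using U by (force intro!: div_le_mono)
    then have "card (?f ` U) \<le> y div (g + 1) + 1" using card_mono[of "{..y div (g + 1)}" "?f ` U"] by simp
    moreover have "y div (g + 1) + 1 < card U"
    proof (rule ccontr)
      assume "\<not> ?thesis"
      then have "card U * (g * (g + 1)) \<le> (y div (g + 1) + 1) * (g * (g + 1))" by (intro mult_right_mono) auto
      also have "\<dots> = g * (y div (g + 1) * (g + 1)) + g * (g + 1)" by (simp add: algebra_simps)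
      also have "\<dots> \<le> g * y + y"
        using y by (intro add_mono mult_left_mono) (auto simp only: div_times_less_eq_dividend)
      finally have "(g * card U) * (g + 1) \<le> y * (g + 1)" by (simp add: algebra_simps)
      then show False using U(2) by (simp only: mult_le_cancel2) linarith
    qed
    ultimately have "\<not> inj_on ?f U" using card_image[of ?f U] by linarith
    then obtain u v where uv: "u \<in> U" "v \<in> U" "u \<noteq> v" "?f u = ?f v" by (auto simp: inj_on_def)
    have *: "u - v \<le> g" if "u \<in> U" "v \<in> U" "?f u = ?f v" for u v
    proof -
      have "u - y < (u - y) div (g + 1) * (g + 1) + (g + 1)"
        using dividend_less_div_times[of "g + 1" "u - y"] by (simp only: add.commute)
      moreover have "(v - y) div (g + 1) * (g + 1) \<le> v - y" by (rule div_times_less_eq_dividend)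
      ultimately have "u - y < v - y + (g + 1)" using that by simp
      moreover have "y \<le> v" using that U by auto
      ultimately show ?thesis by linarith
    qed
    show thesis using that[of u v] that[of v u] uv *[of u v] *[of v u] by (metis nat_neq_iff)
  qed
  \<comment> \<open>One of the terms serves as the modulus. All terms lie between R y and 2 R y, so
    they are distinct modulo w.\<close>
  define w where "w = ?b u"
  have w: "w > 0" "w \<in> ?T" using uv Rpos by (auto simp: w_def intro: add_pos_nonneg)
  have uy: "y \<le> u" "u < 2 * y" using uv U by auto
  have w_ge: "int R * int y < w"
  proof -
    have "int R * int y \<le> int R * int u" using uy by (intro mult_left_mono) auto
    then show ?thesis by (simp add: w_def)
  qed
  have b_le: "?b t \<le> 2 * int R * int y" if "t < 2 * y" for t
  proof -
    have "int R * int t \<le> int R * (2 * int y - 1)" using that by (intro mult_left_mono) auto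
    then show ?thesis using Rpos by (simp add: algebra_simps)
  qed
  have inj: "inj_on (\<lambda>t. t mod w) ?T"
  proof (rule inj_onI)
    fix s t assume "s \<in> ?T" "t \<in> ?T" and eq: "s mod w = t mod w"
    then obtain s' t' where st: "s' \<in> U" "t' \<in> U" "s = ?b s'" "t = ?b t'" by auto
    have bnd: "int R * \<bar>int s' - int t'\<bar> \<le> int R * int y"
    proof (intro mult_left_mono)
      have "s' \<in> {y..<2 * y}" "t' \<in> {y..<2 * y}" using st U by auto
      then show "\<bar>int s' - int t'\<bar> \<le> int y" by auto
    qed simp
    have "\<bar>s - t\<bar> = int R * \<bar>int s' - int t'\<bar>"
      using st by (simp add: abs_mult flip: right_diff_distrib)
    then have "\<bar>s - t\<bar> < w" using w_ge bnd by linarith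
    moreover have "w dvd s - t" using eq by (simp add: mod_eq_dvd_iff)
    ultimately show "s = t" using dvd_imp_le_int[of "s - t" w] w by (cases "s = t") auto
  qed
  \<comment> \<open>w is 1 modulo R, and u - v \<le> g divides R = g!.\<close>
  have cop: "coprime w (int R * int (u - v))"
  proof -
    have "u - v dvd R" using uv R by (auto intro: dvd_fact)
    then have "int (u - v) dvd int R" by simp
    then have "coprime w (int (u - v))" if "coprime w (int R)"
      using that coprime_divisors dvd_refl by blast
    moreover have "coprime w (int R)" 
      unfolding w_def by (metis coprime_mult_left_iff coprime_add_one_left add.commute coprime_commute)
    ultimately show ?thesis by simp
  qed
  have dif: "int R * int (u - v) = ?b u - ?b v" using uv by (simp add: of_nat_diff right_diff_distrib)
  \<comment> \<open>For this i the product i card U exceeds 2 R y \<ge> w, so growth by card U every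
    three steps has exhausted the residues.\<close>
  define i where "i = 3 * R * g + 1"
  have full: "{0..<w} \<subseteq> (\<lambda>v. v mod w) ` signed_sums ?T (3 * i)"
  proof (rule ccontr)
    assume "\<not> ?thesis"
    then have "i * card ?T \<le> card ((\<lambda>v. v mod w) ` signed_sums ?T (3 * i))"
      using signed_sums_residues_grow[OF w(1) inj cop w(2) _ _ dif, of i] uv by auto
    also have "\<dots> \<le> card {0..<w}" using w by (intro card_mono) auto
    finally have le: "int i * int (card U) \<le> w" using w cardT by (simp add: le_nat_iff)
    have "2 * (R * y) \<le> 3 * R * g * card U"
      using mult_left_mono[of y "g * card U" "3 * R"] U(2) by (simp add: algebra_simps)
    moreover have "0 < card U" using U(2) by (cases "card U") auto
    ultimately have "2 * (R * y) < i * card U" unfolding i_def add_mult_distrib by linarith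
    then have "int (2 * (R * y)) < int (i * card U)" by (simp only: of_nat_less_iff)
    then show False using le b_le[OF uy(2)] by (simp add: w_def)
  qed
  fix z assume z: "z \<in> {0..int (8 * R * y)}"
  have "z mod w \<in> {0..<w}" using w by simp
  then obtain s where s: "s \<in> signed_sums ?T (3 * i)" "z mod w = s mod w" using full by blast
  \<comment> \<open>It remains to correct by a multiple of w. As |s| \<le> 6 i R y and w > R y, the
    multiplier satisfies |j| \<le> 6 i + 8, and the total number of steps is 9 i + 8 = 27 R g +
    17.\<close>
  then obtain j where j: "z = s + j * w" by (metis mod_eqE mult.commute)
  have "\<bar>s\<bar> \<le> int (3 * i) * (2 * int R * int y)"
  proof (rule signed_sums_abs_le[OF _ _ s(1)])
    fix t assume "t \<in> ?T"
    then show "\<bar>t\<bar> \<le> 2 * int R * int y" using b_le U by (auto simp: abs_of_nonneg)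
  qed simp
  then have "\<bar>j * w\<bar> \<le> 8 * (int R * int y) + int (6 * i) * (int R * int y)"
    using j z by (auto simp: algebra_simps)
  also have "\<dots> = (8 + int (6 * i)) * (int R * int y)" by (simp add: algebra_simps)
  finally have le: "\<bar>j\<bar> * w \<le> (8 + int (6 * i)) * (int R * int y)" using w by (simp add: abs_mult)
  have "\<bar>j\<bar> \<le> 8 + int (6 * i)"
  proof (rule ccontr)
    assume "\<not> ?thesis"
    then have "(8 + int (6 * i)) * (int R * int y) < \<bar>j\<bar> * w"
      using w_ge Rpos ypos by (intro mult_strict_mono) auto
    then show False using le by simp
  qed
  then have "nat \<bar>j\<bar> \<le> 8 + 6 * i" by linarith
  then have "3 * i + nat \<bar>j\<bar> \<le> 27 * R * g + 17" by (simp add: i_def)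
  moreover have "z \<in> signed_sums ?T (3 * i + nat \<bar>j\<bar>)"
    using signed_sums_add_mult[OF s(1) w(2), of j] j by simp
  ultimately show "z \<in> signed_sums ?T (27 * R * g + 17)" using signed_sums_mono by blast
qed

section \<open>Random blocks\<close>

definition add_term :: "nat \<Rightarrow> int set \<Rightarrow> nat \<Rightarrow> int set" where
  "add_term R S u = S \<union> (\<lambda>s. s + (1 + int R * int u)) ` S"

text \<open>The start set S is a parameter so that a term can be absorbed into it:
  \<open>sums_from_insert\<close> peels off one random choice at a time.\<close>

definition sums_from :: "nat \<Rightarrow> int set \<Rightarrow> ('i \<Rightarrow> nat) \<Rightarrow> 'i set \<Rightarrow> int set" where
  "sums_from R S f I = {s + (\<Sum>i\<in>F. 1 + int R * int (f i)) | s F. s \<in> S \<and> F \<subseteq> I}"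

lemma sums_from_empty [simp]: "sums_from R S f {} = S"
  by (auto simp: sums_from_def)

lemma sums_from_superset: "S \<subseteq> sums_from R S f I"
  by (force simp: sums_from_def)

lemma sums_from_insert:
  assumes "finite I" "x \<notin> I"
  shows "sums_from R S f (insert x I) = sums_from R (add_term R S (f x)) f I"
proof (intro equalityI subsetI)
  let ?b = "\<lambda>i. 1 + int R * int (f i)"
  fix z assume "z \<in> sums_from R S f (insert x I)"
  then obtain s F where z: "z = s + sum ?b F" "s \<in> S" "F \<subseteq> insert x I" by (auto simp: sums_from_def)
  have finF: "finite F" using z(3) assms finite_subset by blast
  show "z \<in> sums_from R (add_term R S (f x)) f I"
  proof (cases "x \<in> F")
    case True
    then have "z = (s + ?b x) + sum ?b (F - {x})" using z finF by (simp add: sum.remove)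
    moreover have "s + ?b x \<in> add_term R S (f x)" "F - {x} \<subseteq> I" using z by (auto simp: add_term_def)
    ultimately show ?thesis unfolding sums_from_def by blast
  next
    case False
    then have "s \<in> add_term R S (f x)" "F \<subseteq> I" using z by (auto simp: add_term_def)
    then show ?thesis using z(1) unfolding sums_from_def by blast
  qed
next
  let ?b = "\<lambda>i. 1 + int R * int (f i)"
  fix z assume "z \<in> sums_from R (add_term R S (f x)) f I"
  then obtain s F where z: "z = s + sum ?b F" "s \<in> add_term R S (f x)" "F \<subseteq> I" by (auto simp: sums_from_def)
  have finF: "finite F" "x \<notin> F" using z(3) assms finite_subset by blast+
  from z(2) consider "s \<in> S" | t where "t \<in> S" "s = t + ?b x" by (auto simp: add_term_def)
  then show "z \<in> sums_from R S f (insert x I)"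
  proof cases
    case 1
    then show ?thesis using z unfolding sums_from_def by blast
  next
    case 2
    then have "z = t + sum ?b (insert x F)" using z finF by simp
    moreover have "insert x F \<subseteq> insert x I" using z by auto
    ultimately show ?thesis using 2 unfolding sums_from_def by blast
  qed
qed

lemma sums_from_cong:
  assumes "\<And>i. i \<in> I \<Longrightarrow> f i = f' i"
  shows "sums_from R S f I = sums_from R S f' I"
proof -
  have "(\<Sum>i\<in>F. 1 + int R * int (f i)) = (\<Sum>i\<in>F. 1 + int R * int (f' i))" if "F \<subseteq> I" for F
    using that assms by (intro sum.cong) auto
  then show ?thesis unfolding sums_from_def by (metis (no_types, lifting))
qed

text \<open>\<open>P\<close> bounds the number of steps that still make progress. Each of the other steps has only
  a proportion \<open>\<gamma>\<close> of all choices.\<close>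

lemma card_bad_choices_le:
  fixes P :: "int set \<Rightarrow> real" and \<gamma> :: real and inv :: "nat \<Rightarrow> int set \<Rightarrow> bool" and I :: "'i set"
  assumes X: "finite X" and \<gamma>: "0 < \<gamma>"
    and inv: "\<And>m S u. inv (Suc m) S \<Longrightarrow> u \<in> X \<Longrightarrow> inv m (add_term R S u)"
    and P_mono: "\<And>m S u. inv (Suc m) S \<Longrightarrow> u \<in> X \<Longrightarrow> P (add_term R S u) \<le> P S"
    and P_nonneg: "\<And>S. inv 0 S \<Longrightarrow> 0 \<le> P S"
    and fails: "\<And>m S. inv (Suc m) S \<Longrightarrow> \<not> dense_window W S \<Longrightarrow>
        real (card {u \<in> X. P S - 1 < P (add_term R S u)}) \<le> \<gamma> * card X"
    and \<gamma>1: "\<gamma> \<le> 1"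
  shows "finite I \<Longrightarrow> inv (card I) S \<Longrightarrow>
    real (card {f \<in> I \<rightarrow>\<^sub>E X. \<not> dense_window W (sums_from R S f I)})
      \<le> (2 * card X) ^ card I * \<gamma> powr (card I - P S)"
proof (induction I arbitrary: S rule: finite_induct)
  case empty
  have "card {f \<in> ({} :: 'i set) \<rightarrow>\<^sub>E X. \<not> dense_window W (sums_from R S f {})} \<le> card ({\<lambda>_. undefined} :: ('i \<Rightarrow> nat) set)"
    by (intro card_mono) auto
  \<comment> \<open>No choice is left. The claimed bound is at least 1 because P is nonnegative at
    the end.\<close>
  moreover have "1 \<le> \<gamma> powr - P S"
    using powr_mono'[of "- P S" 0 \<gamma>] P_nonneg[of S] empty \<gamma> \<gamma>1 by simp
  ultimately show ?case by simp
next
  case (insert x I)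
  let ?n = "card I"
  let ?Bad = "\<lambda>S. {f \<in> I \<rightarrow>\<^sub>E X. \<not> dense_window W (sums_from R S f I)}"
  let ?Big = "{f \<in> insert x I \<rightarrow>\<^sub>E X. \<not> dense_window W (sums_from R S f (insert x I))}"
  have finI: "finite (I \<rightarrow>\<^sub>E X)" using insert.hyps X by (intro finite_PiE) auto
  have finBad: "finite (?Bad S)" for S using finI by simp
  have inv': "inv (Suc ?n) S" using insert by simp
  show ?case
  proof (cases "dense_window W S")
    case True
    then have "?Big = {}" using dense_window_mono[OF True sums_from_superset] by blast
    then have "card ?Big = 0" by (simp only: card.empty)
    then show ?thesis using \<gamma> by simp
  next
    case False
    let ?K = "(2 * card X) ^ ?n * \<gamma> powr (?n - P S)"
    have "card ?Big \<le> card (SIGMA u:X. ?Bad (add_term R S u))"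
    proof (rule card_inj_on_le)
      let ?h = "\<lambda>f. (f x, restrict f I)"
      show "inj_on ?h ?Big"
      proof (rule inj_onI)
        fix f g assume fg: "f \<in> ?Big" "g \<in> ?Big" "?h f = ?h g"
        show "f = g"
        proof (rule PiE_ext)
          show "f \<in> insert x I \<rightarrow>\<^sub>E X" "g \<in> insert x I \<rightarrow>\<^sub>E X" using fg by auto
          show "f i = g i" if "i \<in> insert x I" for i using fg(3) that by (auto dest: fun_cong[of _ _ i])
        qed
      qed
      show "?h ` ?Big \<subseteq> (SIGMA u:X. ?Bad (add_term R S u))"
      proof (rule image_subsetI)
        fix f assume f: "f \<in> ?Big"
        have "sums_from R (add_term R S (f x)) (restrict f I) I = sums_from R (add_term R S (f x)) f I"
          by (rule sums_from_cong) simp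
        then show "?h f \<in> (SIGMA u:X. ?Bad (add_term R S u))"
          using f sums_from_insert[OF insert.hyps, of R S f] by auto
      qed
      show "finite (SIGMA u:X. ?Bad (add_term R S u))" using X finBad by blast
    qed
    also have "\<dots> = (\<Sum>u\<in>X. card (?Bad (add_term R S u)))" using X finBad by simp
    finally have "real (card ?Big) \<le> real (\<Sum>u\<in>X. card (?Bad (add_term R S u)))"
      by (simp only: of_nat_le_iff)
    also have "\<dots> = (\<Sum>u\<in>X. real (card (?Bad (add_term R S u))))" by (rule of_nat_sum)
    \<comment> \<open>Choices without progress number at most \<gamma> card X and do not raise P.
      Those with progress lower P by 1, which is worth a factor \<gamma>. Both contributions have
      the same bound, hence the factor 2 per step.\<close>
    also have "\<dots> \<le> (\<Sum>u\<in>X. (if P S - 1 < P (add_term R S u) then ?K else 0) + ?K * \<gamma>)"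
    proof (rule sum_mono)
      fix u assume u: "u \<in> X"
      have IH: "real (card (?Bad (add_term R S u))) \<le> (2 * card X) ^ ?n * \<gamma> powr (?n - P (add_term R S u))"
        using insert.IH inv[OF inv' u] by simp
      show "real (card (?Bad (add_term R S u))) \<le> (if P S - 1 < P (add_term R S u) then ?K else 0) + ?K * \<gamma>"
      proof (cases "P S - 1 < P (add_term R S u)")
        case True
        have "\<gamma> powr (?n - P (add_term R S u)) \<le> \<gamma> powr (?n - P S)"
          using P_mono[OF inv' u] \<gamma> \<gamma>1 by (intro powr_mono') auto
        then have "(2 * card X) ^ ?n * \<gamma> powr (?n - P (add_term R S u)) \<le> ?K" by (intro mult_left_mono) auto
        moreover have "0 \<le> ?K * \<gamma>" using \<gamma> by simp
        ultimately show ?thesis using IH by (simp only: True if_True)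
      next
        case False
        have "\<gamma> powr (?n - P (add_term R S u)) \<le> \<gamma> powr (?n - P S + 1)"
          using False \<gamma> \<gamma>1 by (intro powr_mono') auto
        also have "\<dots> = \<gamma> powr (?n - P S) * \<gamma>" using \<gamma> by (simp add: powr_add)
        finally have "(2 * card X) ^ ?n * \<gamma> powr (?n - P (add_term R S u)) \<le> (2 * card X) ^ ?n * (\<gamma> powr (?n - P S) * \<gamma>)"
          by (intro mult_left_mono) auto
        then show ?thesis using IH by (simp only: False if_False add_0 mult.assoc)
      qed
    qed
    also have "\<dots> = real (card {u \<in> X. P S - 1 < P (add_term R S u)}) * ?K + card X * (?K * \<gamma>)"
      using X by (simp add: sum.distrib sum.If_cases Int_def)
    also have "\<dots> \<le> (\<gamma> * card X) * ?K + card X * (?K * \<gamma>)"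
      using fails[OF inv' False] by (intro add_right_mono mult_right_mono) auto
    also have "\<dots> = (2 * card X) ^ Suc ?n * (\<gamma> powr (?n - P S) * \<gamma>)" by (simp add: algebra_simps)
    also have "\<gamma> powr (?n - P S) * \<gamma> = \<gamma> powr (Suc ?n - P S)"
      using powr_add[of \<gamma> "?n - P S" 1] \<gamma> by (simp add: algebra_simps)
    finally show ?thesis using insert.hyps by simp
  qed
qed

text \<open>Bounds the number of growth steps left to a set of size x: factors 3/2 up to the size
  \<theta>, then factors 1 + \<eta> up to the size M.\<close>

definition growth_potential :: "real \<Rightarrow> real \<Rightarrow> real \<Rightarrow> real \<Rightarrow> real" where
  "growth_potential \<theta> M \<eta> x =
     max 0 (ln \<theta> - ln x) / ln (3/2) + (ln M - max (ln x) (ln \<theta>)) / ln (1 + \<eta>)"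

lemma growth_potential_antimono:
  assumes "0 < x" "x \<le> x'" "0 < \<eta>"
  shows "growth_potential \<theta> M \<eta> x' \<le> growth_potential \<theta> M \<eta> x"
proof -
  have "ln x \<le> ln x'" using assms by simp
  then have "max 0 (ln \<theta> - ln x') \<le> max 0 (ln \<theta> - ln x)" "ln M - max (ln x') (ln \<theta>) \<le> ln M - max (ln x) (ln \<theta>)"
    by linarith+
  then show ?thesis unfolding growth_potential_def
    using assms(3) by (intro add_mono divide_right_mono) auto
qed

lemma growth_potential_nonneg:
  assumes "0 < x" "x \<le> M" "0 < \<theta>" "\<theta> \<le> M" "0 < \<eta>"
  shows "0 \<le> growth_potential \<theta> M \<eta> x"
  unfolding growth_potential_def using assms by (intro add_nonneg_nonneg divide_nonneg_nonneg) auto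

text \<open>If the step overshoots \<theta>, the excess is measured at the slower rate ln (1 +
  \<eta>) \<le> ln (3/2), which lowers the potential even more; this is where \<eta> \<le> 1/2
  enters.\<close>

lemma growth_potential_early:
  assumes "0 < x" "x \<le> \<theta>" "3/2 * x \<le> x'" "0 < \<eta>" "\<eta> \<le> 1/2"
  shows "growth_potential \<theta> M \<eta> x' \<le> growth_potential \<theta> M \<eta> x - 1"
proof -
  define D e where "D = ln (3/2 :: real)" and "e = ln (1 + \<eta>)"
  have D: "0 < D" "0 < e" "e \<le> D" using assms by (auto simp: D_def e_def)
  have "ln x + D = ln (3/2 * x)" using assms ln_mult[of "3/2" x] by (simp add: D_def)
  also have "\<dots> \<le> ln x'" using assms by simp
  finally have step: "1 \<le> (ln x' - ln x) / D" using D by (simp add: le_divide_eq)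
  have x: "ln x \<le> ln \<theta>" using assms by simp
  have "growth_potential \<theta> M \<eta> x' \<le> (ln \<theta> - ln x') / D + (ln M - ln \<theta>) / e"
  proof (cases "ln x' \<le> ln \<theta>")
    case False
    have "(ln x' - ln \<theta>) / D \<le> (ln x' - ln \<theta>) / e" using False D by (intro divide_left_mono) auto
    then have "(ln M - ln x') / e \<le> (ln \<theta> - ln x') / D + (ln M - ln \<theta>) / e"
      by (simp add: diff_divide_distrib)
    then show ?thesis using False by (simp add: growth_potential_def D_def e_def)
  qed (simp add: growth_potential_def D_def e_def)
  also have "\<dots> = growth_potential \<theta> M \<eta> x - (ln x' - ln x) / D"
    using x by (simp add: growth_potential_def D_def e_def diff_divide_distrib)
  finally show ?thesis using step by linarith
qed

lemma growth_potential_late: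
  assumes "0 < \<theta>" "\<theta> < x" "(1 + \<eta>) * x \<le> x'" "0 < \<eta>"
  shows "growth_potential \<theta> M \<eta> x' \<le> growth_potential \<theta> M \<eta> x - 1"
proof -
  define e where "e = ln (1 + \<eta>)"
  have e: "0 < e" using assms by (simp add: e_def)
  have "0 < (1 + \<eta>) * x" using assms by simp
  then have "ln x + e \<le> ln x'" using assms ln_mult[of "1 + \<eta>" x] ln_mono[of "(1 + \<eta>) * x" x'] by (simp add: e_def)
  moreover have "ln \<theta> < ln x" using assms by simp
  ultimately have "growth_potential \<theta> M \<eta> x' = (ln M - ln x') / e"
      "growth_potential \<theta> M \<eta> x = (ln M - ln x) / e" "1 \<le> (ln x' - ln x) / e"
    using e by (auto simp: growth_potential_def e_def[symmetric])
  then show ?thesis by (simp add: diff_divide_distrib)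
qed

text \<open>Otherwise the terms with small defect are so many that every shift up to 8 R y is a
  signed sum of 27 R g + 17 of them. The value of \<eta> makes the total defect at most |S|/8, and S
  would have a dense window.\<close>

lemma card_few_growing_terms_le:
  fixes g R y :: nat and \<eta> :: real and S :: "int set"
  assumes g: "g \<ge> 1" and R: "R = fact g" and y: "y \<ge> g * (g + 1)"
    and \<eta>: "\<eta> = 1 / real (8 * (27 * R * g + 17))"
    and S: "finite S" "S \<noteq> {}" "\<not> dense_window (8 * R * y) S"
  shows "g * card {u \<in> {y..<2 * y}. real (shift_defect S (1 + int R * int u)) < \<eta> * card S} \<le> y"
proof (rule ccontr)
  let ?U = "{u \<in> {y..<2 * y}. real (shift_defect S (1 + int R * int u)) < \<eta> * card S}"
  let ?k = "27 * R * g + 17"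
  assume "\<not> ?thesis"
  then have cover: "{0..int (8 * R * y)} \<subseteq> signed_sums ((\<lambda>u. 1 + int R * int u) ` ?U) ?k"
    by (intro signed_sums_cover_interval[OF g R y]) auto
  have "dense_window (8 * R * y) S"
  proof (rule dense_window_if_shift_defect_small[OF S(1,2)])
    fix x assume "x \<in> {1..int (8 * R * y)}"
    then have "x \<in> signed_sums ((\<lambda>u. 1 + int R * int u) ` ?U) ?k" using cover by force
    then have "real (shift_defect S x) \<le> ?k * (\<eta> * card S)"
      by (intro shift_defect_signed_sums_le[OF S(1)]) (auto simp: \<eta>)
    also have "\<dots> = real ?k * \<eta> * card S" by simp
    also have "real ?k * \<eta> = 1 / 8"
    proof -
      have *: "c * (1 / (8 * c)) = 1 / 8" if "0 < c" for c :: real using that by simp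
      have "\<eta> = 1 / (8 * real ?k)" unfolding \<eta> by (simp only: of_nat_mult of_nat_numeral)
      then show ?thesis by (simp only:) (rule *, subst of_nat_0_less_iff, simp)
    qed
    finally show "8 * shift_defect S x \<le> card S" by simp
  qed
  then show False using S by simp
qed

lemma card_bad_choices_block_le:
  fixes g R y n :: nat and \<eta> :: real and J :: "'i set"
  assumes g: "g \<ge> 1" and R: "R = fact g" and y: "y \<ge> g * (g + 1)" and n: "n \<ge> 1"
    and \<eta>: "\<eta> = 1 / real (8 * (27 * R * g + 17))" and J: "finite J" "card J = n"
  shows "real (card {f \<in> J \<rightarrow>\<^sub>E {y..<2 * y}. \<not> dense_window (8 * R * y) (sums_from R {0} f J)})
    \<le> (2 * y) ^ n * (1 / g) powr (n - growth_potential (y / (2 * g)) (4 * n * R * y) \<eta> 1)"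
proof -
  \<comment> \<open>For |S| \<le> \<theta> at most 2 |S| \<le> y/g choices fail to enlarge S by
    half. Beyond \<theta>, \<open>card_few_growing_terms_le\<close> gives the same proportion 1/g
    for growth by 1 + \<eta>. M bounds the number of integers between 0 and the largest possible
    sum.\<close>
  define \<theta> M where "\<theta> = real y / (2 * g)" and "M = real (4 * n * R * y)"
  define P where "P S = growth_potential \<theta> M \<eta> (card S)" for S :: "int set"
  \<comment> \<open>Here m is the number of terms still to be added; each of the n - m earlier ones
    is at most 2 R y.\<close>
  define inv where "inv m S \<longleftrightarrow> m \<le> n \<and> finite S \<and> 0 \<in> S \<and> S \<subseteq> {0..int ((n - m) * (2 * R * y))}"
    for m and S :: "int set"
  have Rpos: "R \<ge> 1" using R by (simp add: fact_ge_1)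
  have "g * 2 \<le> g * (g + 1)" using g by (intro mult_left_mono) auto
  then have yg: "2 * g \<le> y" using y by linarith
  have ypos: "y \<ge> 1" using yg g by simp
  have "0 < 1 / c \<and> 1 / c \<le> 1 / 2" if "2 \<le> c" for c :: real
    using that by (auto intro: divide_left_mono)
  moreover have "real 2 \<le> real (8 * (27 * R * g + 17))" unfolding of_nat_le_iff by simp
  ultimately have \<eta>pos: "0 < \<eta>" "\<eta> \<le> 1/2" unfolding \<eta> by (metis of_nat_numeral)+
  have \<theta>pos: "0 < \<theta>" using g ypos by (simp add: \<theta>_def)
  have pos: "0 < card S" if "inv m S" for m S using that by (auto simp: inv_def card_gt_0_iff)
  have card_step: "card (add_term R S u) = card S + shift_defect S (1 + int R * int u)" if "inv m S" for m S u
    using that card_Un_shift by (simp add: inv_def add_term_def)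
  have "real (card {f \<in> J \<rightarrow>\<^sub>E {y..<2 * y}. \<not> dense_window (8 * R * y) (sums_from R {0} f J)})
      \<le> (2 * card {y..<2 * y}) ^ card J * (1 / g) powr (card J - P {0})"
  proof (rule card_bad_choices_le[where inv = inv])
    show "inv m (add_term R S u)" if "inv (Suc m) S" "u \<in> {y..<2 * y}" for m S u
    proof -
      have "R * (u + 1) \<le> R * (2 * y)" using that by (intro mult_left_mono) auto
      then have "1 + R * u \<le> 2 * R * y" using Rpos by (simp add: algebra_simps)
      then have b: "1 + int R * int u \<le> int (2 * R * y)" by (simp flip: of_nat_mult of_nat_le_iff)
      have "n - m = Suc (n - Suc m)" using that by (auto simp: inv_def)
      then have nm: "(n - m) * (2 * R * y) = (n - Suc m) * (2 * R * y) + 2 * R * y"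
        by (simp only: mult_Suc add.commute)
      have "s \<in> {0..int ((n - m) * (2 * R * y))} \<and> s + (1 + int R * int u) \<in> {0..int ((n - m) * (2 * R * y))}"
        if "s \<in> S" for s
      proof -
        have "s \<in> {0..int ((n - Suc m) * (2 * R * y))}" using that \<open>inv (Suc m) S\<close> by (auto simp: inv_def)
        moreover have "0 \<le> int R * int u" by simp
        ultimately show ?thesis unfolding nm of_nat_add atLeastAtMost_iff using b by linarith
      qed
      then show ?thesis using that unfolding inv_def add_term_def by auto
    qed
    show "P (add_term R S u) \<le> P S" if "inv (Suc m) S" "u \<in> {y..<2 * y}" for m S u
      unfolding P_def using pos[OF that(1)] card_step[OF that(1)] \<eta>pos by (intro growth_potential_antimono) auto
    show "0 \<le> P S" if "inv 0 S" for S
    proof -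
      have "card S \<le> card {0..int (n * (2 * R * y))}" using that by (intro card_mono) (auto simp: inv_def)
      also have "\<dots> = n * (2 * R * y) + 1"
        using card_atLeastAtMost_int[of 0 "int (n * (2 * R * y))"] by linarith
      also have "\<dots> \<le> 4 * n * R * y"
      proof -
        have "1 \<le> n * R * y" using n Rpos ypos by simp
        moreover have "n * (2 * R * y) = 2 * (n * R * y)" "4 * n * R * y = 4 * (n * R * y)" by simp_all
        ultimately show ?thesis by linarith
      qed
      finally have "real (card S) \<le> M" unfolding M_def by (simp only: of_nat_le_iff)
      moreover have "\<theta> \<le> M"
      proof -
        have "\<theta> \<le> real y" using g by (simp add: \<theta>_def divide_le_eq mult_le_cancel_left1)
        also have "y \<le> 4 * n * R * y" using n Rpos by simp
        then have "real y \<le> M" unfolding M_def by (simp only: of_nat_le_iff)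
        finally show ?thesis .
      qed
      ultimately show ?thesis unfolding P_def using pos[OF that] \<theta>pos \<eta>pos by (intro growth_potential_nonneg) auto
    qed
    show "real (card {u \<in> {y..<2 * y}. P S - 1 < P (add_term R S u)}) \<le> 1 / real g * card {y..<2 * y}"
      if S: "inv (Suc m) S" "\<not> dense_window (8 * R * y) S" for m S
    proof -
      let ?b = "\<lambda>u. 1 + int R * int u"
      let ?X = "{y..<2 * y}"
      let ?F = "{u \<in> ?X. P S - 1 < P (add_term R S u)}"
      have finS: "finite S" "S \<noteq> {}" using S by (auto simp: inv_def)
      have "g * card ?F \<le> y"
      proof (cases "real (card S) \<le> \<theta>")
        case True
        have sub: "?b ` ?F \<subseteq> {b \<in> ?b ` ?X. 2 * shift_defect S b < card S}"
        proof (rule image_subsetI)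
          fix u assume u: "u \<in> ?F"
          have "2 * shift_defect S (?b u) < card S"
          proof (rule ccontr)
            assume "\<not> ?thesis"
            then have "3/2 * real (card S) \<le> real (card (add_term R S u))"
              unfolding card_step[OF S(1)] by simp
            then have "P (add_term R S u) \<le> P S - 1" unfolding P_def
              using True pos[OF S(1)] \<eta>pos by (intro growth_potential_early) auto
            then show False using u by simp
          qed
          then show "?b u \<in> {b \<in> ?b ` ?X. 2 * shift_defect S b < card S}" using u by auto
        qed
        have "card ?F = card (?b ` ?F)" using Rpos by (intro card_image[symmetric]) (auto simp: inj_on_def)
        also have "\<dots> \<le> card {b \<in> ?b ` ?X. 2 * shift_defect S b < card S}"
          using sub by (intro card_mono) auto
        also have "\<dots> \<le> 2 * card S" using finS by (intro card_small_shift_defect_le) auto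
        finally have "g * card ?F \<le> g * (2 * card S)" by simp
        moreover have "real (g * (2 * card S)) \<le> real y" using True g by (simp add: \<theta>_def field_simps)
        ultimately show ?thesis by linarith
      next
        case False
        have sub: "?F \<subseteq> {u \<in> ?X. real (shift_defect S (?b u)) < \<eta> * card S}"
        proof
          fix u assume u: "u \<in> ?F"
          have "real (shift_defect S (?b u)) < \<eta> * card S"
          proof (rule ccontr)
            assume "\<not> ?thesis"
            then have "(1 + \<eta>) * real (card S) \<le> real (card (add_term R S u))"
              unfolding card_step[OF S(1)] by (simp add: algebra_simps)
            then have "P (add_term R S u) \<le> P S - 1" unfolding P_def
              using False \<theta>pos \<eta>pos by (intro growth_potential_late) auto
            then show False using u by simp
          qed
          then show "u \<in> {u \<in> ?X. real (shift_defect S (?b u)) < \<eta> * card S}" using u by auto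
        qed
        have "g * card ?F \<le> g * card {u \<in> ?X. real (shift_defect S (?b u)) < \<eta> * card S}"
          using sub by (intro mult_left_mono card_mono) auto
        also have "\<dots> \<le> y" by (rule card_few_growing_terms_le[OF g R y \<eta> finS S(2)])
        finally show ?thesis .
      qed
      then have "real (g * card ?F) \<le> real y" by (simp only: of_nat_le_iff)
      then show ?thesis using g by (simp add: field_simps)
    qed
    show "inv (card J) {0}" by (simp add: inv_def J)
  qed (use g J in auto)
  then show ?thesis by (simp add: J P_def \<theta>_def M_def)
qed

lemma card_PiE_restrict_le:
  assumes "finite I" "J \<subseteq> I" "finite X"
  shows "card {f \<in> I \<rightarrow>\<^sub>E X. Q (restrict f J)} \<le> card {f \<in> J \<rightarrow>\<^sub>E X. Q f} * card X ^ (card I - card J)"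
proof -
  have fin: "finite J" using assms finite_subset by blast
  let ?h = "\<lambda>f. (restrict f J, restrict f (I - J))"
  have "card {f \<in> I \<rightarrow>\<^sub>E X. Q (restrict f J)} \<le> card ({f \<in> J \<rightarrow>\<^sub>E X. Q f} \<times> ((I - J) \<rightarrow>\<^sub>E X))"
  proof (rule card_inj_on_le)
    show "inj_on ?h {f \<in> I \<rightarrow>\<^sub>E X. Q (restrict f J)}"
    proof (rule inj_onI)
      fix f g assume fg: "f \<in> {f \<in> I \<rightarrow>\<^sub>E X. Q (restrict f J)}" "g \<in> {f \<in> I \<rightarrow>\<^sub>E X. Q (restrict f J)}" "?h f = ?h g"
      show "f = g"
      proof (rule PiE_ext)
        show "f \<in> I \<rightarrow>\<^sub>E X" "g \<in> I \<rightarrow>\<^sub>E X" using fg by auto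
        fix i assume i: "i \<in> I"
        have "restrict f J i = restrict g J i" "restrict f (I - J) i = restrict g (I - J) i" using fg(3) by auto
        then show "f i = g i" using i by (cases "i \<in> J") auto
      qed
    qed
    show "?h ` {f \<in> I \<rightarrow>\<^sub>E X. Q (restrict f J)} \<subseteq> {f \<in> J \<rightarrow>\<^sub>E X. Q f} \<times> ((I - J) \<rightarrow>\<^sub>E X)"
      using assms by auto
    show "finite ({f \<in> J \<rightarrow>\<^sub>E X. Q f} \<times> ((I - J) \<rightarrow>\<^sub>E X))"
      using assms fin
      by (intro finite_cartesian_product finite_Collect_conjI disjI1) (simp_all add: finite_PiE)
  qed
  then show ?thesis using assms fin by (simp add: card_cartesian_product card_PiE card_Diff_subset)
qed

section \<open>Completeness\<close>

text \<open>Pigeonhole: the window part of S1 and the reflection under x of that of S2 lie in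
  windows of length 2 V offset by at most V. These span at most 3 V + 1 integers but hold 7 V / 2
  points, so they meet. The elements above s1 and s2 will bound the unknown positions of the
  windows.\<close>

lemma dense_windows_add_interval:
  fixes S1 S2 :: "int set" and V :: nat
  assumes S: "dense_window (2 * V) S1" "dense_window (2 * V) S2" and V: "V \<ge> 4"
  shows "\<exists>s1 s2. (\<exists>a\<in>S1. s1 < a) \<and> (\<exists>b\<in>S2. s2 < b) \<and>
    (\<forall>x\<in>{s1 + s2 + int V..s1 + s2 + 3 * int V}. \<exists>a\<in>S1. \<exists>b\<in>S2. x = a + b)"
proof -
  obtain s1 s2 where s: "7 * (2 * V) \<le> 8 * card (S1 \<inter> {s1<..s1 + int (2 * V)})"
      "7 * (2 * V) \<le> 8 * card (S2 \<inter> {s2<..s2 + int (2 * V)})"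
    using S by (auto simp: dense_window_def)
  let ?A = "S1 \<inter> {s1<..s1 + int (2 * V)}" and ?B = "S2 \<inter> {s2<..s2 + int (2 * V)}"
  have "?A \<noteq> {}" "?B \<noteq> {}" using s V by (metis card.empty mult_0_right le_zero_eq mult_is_0 not_numeral_le_zero zero_neq_numeral)+
  then have "\<exists>a\<in>S1. s1 < a" "\<exists>b\<in>S2. s2 < b" by auto
  moreover have "\<exists>a\<in>S1. \<exists>b\<in>S2. x = a + b" if x: "x \<in> {s1 + s2 + int V..s1 + s2 + 3 * int V}" for x
  proof (rule ccontr)
    assume no: "\<not> ?thesis"
    define \<delta> where "\<delta> = x - s1 - s2 - 2 * int V"
    have \<delta>: "\<bar>\<delta>\<bar> \<le> int V" using x by (auto simp: \<delta>_def)
    let ?B' = "(\<lambda>b. x - b) ` ?B"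
    have "?A \<inter> ?B' = {}" using no by force
    then have "card ?A + card ?B' = card (?A \<union> ?B')" by (simp add: card_Un_disjoint)
    also have "\<dots> \<le> card {s1 + min 0 \<delta>..s1 + 2 * int V + max 0 \<delta>}"
      by (intro card_mono) (auto simp: \<delta>_def)
    also have "\<dots> \<le> 3 * V + 1" using \<delta> by (auto simp: min_def max_def)
    finally have "card ?A + card ?B \<le> 3 * V + 1" by (simp add: card_image inj_on_def)
    then show False using s V by linarith
  qed
  ultimately show ?thesis by blast
qed

text \<open>No term exceeds d - c, so the interval built so far and its translate by the next term
  leave no gap.\<close>

lemma interval_extend_by_subset_sums:
  fixes b :: "'i \<Rightarrow> int" and c d :: int
  assumes "finite J" "\<And>i. i \<in> J \<Longrightarrow> 0 \<le> b i \<and> b i \<le> d - c"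
  shows "\<forall>x\<in>{c..d + sum b J}. \<exists>t\<in>{c..d}. \<exists>F\<subseteq>J. x = t + sum b F"
  using assms
proof (induction J rule: finite_induct)
  case (insert j J)
  show ?case
  proof
    fix x assume x: "x \<in> {c..d + sum b (insert j J)}"
    have nn: "0 \<le> sum b J" using insert by (intro sum_nonneg) auto
    show "\<exists>t\<in>{c..d}. \<exists>F\<subseteq>insert j J. x = t + sum b F"
    proof (cases "x \<le> d + sum b J")
      case True
      then have "x \<in> {c..d + sum b J}" using x by auto
      then obtain t F where "t \<in> {c..d}" "F \<subseteq> J" "x = t + sum b F" using insert by blast
      then show ?thesis by blast
    next
      case False
      moreover have "b j \<le> d - c" using insert.prems by simp
      ultimately have "x - b j \<in> {c..d + sum b J}" using x nn insert.hyps by auto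
      then obtain t F where tF: "t \<in> {c..d}" "F \<subseteq> J" "x - b j = t + sum b F" using insert by blast
      then have "finite F" "j \<notin> F" using insert finite_subset by blast+
      then have "x = t + sum b (insert j F)" using tF by simp
      then show ?thesis using tF by blast
    qed
  qed
qed auto

text \<open>Of the 30 n indices, two groups of n produce an interval of length 8 R y and the other
  28 n extend it. The windows start at or below 2 n R y, so the interval starts by 7 n R y; the 28 n
  terms are at least R y each, so it reaches 28 n R y.\<close>

lemma dense_blocks_cover_interval:
  fixes R y n :: nat and f :: "'i \<Rightarrow> nat" and B :: "'i set"
  assumes pos: "R \<ge> 1" "y \<ge> 1" "n \<ge> 2" and B: "finite B" "30 * n \<le> card B"
    and f: "\<And>i. i \<in> B \<Longrightarrow> f i \<in> {y..<2 * y}"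
    and dense: "\<And>J. J \<subseteq> B \<Longrightarrow> card J = n \<Longrightarrow> dense_window (8 * R * y) (sums_from R {0} f J)"
    and x: "7 * n * R * y \<le> x" "x \<le> 28 * n * R * y"
  shows "\<exists>F\<subseteq>B. x = (\<Sum>i\<in>F. 1 + R * f i)"
proof -
  define b where "b i = 1 + int R * int (f i)" for i
  have b: "int (R * y) \<le> b i \<and> b i \<le> int (2 * R * y)" if "i \<in> B" for i
  proof -
    have "R * (f i + 1) \<le> R * (2 * y)" "R * y \<le> R * f i" using f[OF that] by (intro mult_left_mono; auto)+
    moreover have "R * (f i + 1) = R * f i + R" "R * (2 * y) = 2 * R * y" by (simp_all add: algebra_simps)
    ultimately have "R * y \<le> 1 + R * f i" "1 + R * f i \<le> 2 * R * y" using pos(1) by linarith+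
    then have "int (R * y) \<le> int (1 + R * f i)" "int (1 + R * f i) \<le> int (2 * R * y)"
      by (simp_all only: of_nat_le_iff)
    then show ?thesis by (simp add: b_def)
  qed
  obtain J1 where J1: "J1 \<subseteq> B" "card J1 = n" using obtain_subset_with_card_n[of n B] B by auto
  have fin1: "finite J1" using J1 B finite_subset by blast
  have "card (B - J1) \<ge> 29 * n" using J1 B fin1 by (simp add: card_Diff_subset)
  then obtain J2 where J2: "J2 \<subseteq> B - J1" "card J2 = n" using obtain_subset_with_card_n[of n "B - J1"] by auto
  have fin2: "finite J2" using J2 B finite_subset by blast
  define J3 where "J3 = B - J1 - J2"
  have cJ3: "card J3 \<ge> 28 * n" using J1 J2 B fin1 fin2 unfolding J3_def by (simp add: card_Diff_subset)
  have fin3: "finite J3" using B by (simp add: J3_def)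
  have sums: "0 \<le> z \<and> z \<le> int (2 * n * R * y)" if zJ: "z \<in> sums_from R {0} f J" "J \<subseteq> B" "card J = n" for z J
  proof -
    obtain F where F: "F \<subseteq> J" "z = sum b F" using zJ(1) by (auto simp: sums_from_def b_def)
    have "finite J" using zJ B finite_subset by blast
    then have "card F \<le> n" using F(1) zJ(3) card_mono by blast
    have "0 \<le> sum b F" using F by (intro sum_nonneg) (auto simp: b_def)
    moreover have "sum b F \<le> of_nat (card F) * int (2 * R * y)"
      using F(1) zJ(2) b by (intro sum_bounded_above) blast
    moreover have "of_nat (card F) * int (2 * R * y) \<le> int n * int (2 * R * y)"
      using \<open>card F \<le> n\<close> by (intro mult_right_mono) auto
    ultimately show ?thesis using F by (simp add: algebra_simps)
  qed
  let ?S1 = "sums_from R {0} f J1" and ?S2 = "sums_from R {0} f J2"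
  have "dense_window (2 * (4 * R * y)) ?S1" "dense_window (2 * (4 * R * y)) ?S2"
    using dense[of J1] dense[of J2] J1 J2 by (auto simp: mult.assoc)
  moreover have Ry: "1 \<le> R * y" using pos by simp
  then have "4 \<le> 4 * R * y" by simp
  ultimately obtain s1 s2 where ex: "\<exists>a\<in>?S1. s1 < a" "\<exists>b\<in>?S2. s2 < b"
    and cov: "\<And>x. x \<in> {s1 + s2 + int (4 * R * y)..s1 + s2 + 3 * int (4 * R * y)} \<Longrightarrow> \<exists>a\<in>?S1. \<exists>b\<in>?S2. x = a + b"
    using dense_windows_add_interval[of "4 * R * y" ?S1 ?S2] by blast
  have J2B: "J2 \<subseteq> B" using J2 by blast
  obtain z1 z2 where "z1 \<in> ?S1" "s1 < z1" "z2 \<in> ?S2" "s2 < z2" using ex by blast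
  then have s_le: "s1 \<le> int (2 * n * R * y)" "s2 \<le> int (2 * n * R * y)"
    using sums[of z1 J1] sums[of z2 J2] J1 J2 J2B by linarith+
  define c d where "c = s1 + s2 + int (4 * R * y)" and "d = s1 + s2 + 3 * int (4 * R * y)"
  have c0: "0 \<le> c"
  proof -
    \<comment> \<open>The left end is itself a sum of two nonnegative subset sums, so the windows
      cannot lie far to the left.\<close>
    have "c \<in> {s1 + s2 + int (4 * R * y)..s1 + s2 + 3 * int (4 * R * y)}" by (auto simp: c_def)
    then obtain a b where "a \<in> ?S1" "b \<in> ?S2" "c = a + b" using cov by blast
    then show ?thesis using sums[of a J1] sums[of b J2] J1 J2(2) J2B by linarith
  qed
  have dc: "d - c = int (8 * R * y)" by (simp add: c_def d_def)
  have "int (28 * n * R * y) \<le> int (card J3) * int (R * y)"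
  proof -
    have "28 * n * (R * y) \<le> card J3 * (R * y)" using cJ3 by (intro mult_right_mono) auto
    then have "int (28 * n * (R * y)) \<le> int (card J3 * (R * y))" by (simp only: of_nat_le_iff)
    then show ?thesis by (simp add: mult.assoc)
  qed
  also have "\<dots> \<le> sum b J3" using b by (intro sum_bounded_below) (auto simp: J3_def)
  finally have "int x \<le> d + sum b J3" using x(2) c0 dc by linarith
  moreover have "c \<le> int x"
  proof -
    have "4 * (R * y) \<le> 3 * n * (R * y)" using pos by (intro mult_right_mono) auto
    then have "4 * n * R * y + 4 * R * y \<le> 7 * n * R * y" by (simp add: algebra_simps)
    then have "4 * n * R * y + 4 * R * y \<le> x" using x(1) by linarith
    then have "int (4 * n * R * y + 4 * R * y) \<le> int x" by (simp only: of_nat_le_iff)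
    then show ?thesis using s_le unfolding c_def by simp
  qed
  ultimately have "int x \<in> {c..d + sum b J3}" by simp
  moreover have "0 \<le> b i \<and> b i \<le> d - c" if "i \<in> J3" for i
  proof -
    have "0 \<le> int (R * y)" "int (2 * R * y) \<le> int (8 * R * y)" by simp_all
    moreover have "i \<in> B" using that by (simp add: J3_def)
    ultimately show ?thesis using b[of i] dc by linarith
  qed
  ultimately obtain t F3 where tF: "t \<in> {c..d}" "F3 \<subseteq> J3" "int x = t + sum b F3"
    using interval_extend_by_subset_sums[OF fin3, of b d c] by blast
  then obtain a1 a2 where a: "a1 \<in> ?S1" "a2 \<in> ?S2" "t = a1 + a2"
    using cov[of t] unfolding c_def d_def by blast
  obtain F1 F2 where F: "F1 \<subseteq> J1" "a1 = sum b F1" "F2 \<subseteq> J2" "a2 = sum b F2"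
    using a(1,2) by (auto simp: sums_from_def b_def)
  have fins: "finite F1" "finite F2" "finite F3" using F tF fin1 fin2 fin3 finite_subset by blast+
  have "F1 \<inter> F2 = {}" "(F1 \<union> F2) \<inter> F3 = {}" using F tF J2 by (auto simp: J3_def)
  then have "int x = sum b (F1 \<union> F2 \<union> F3)"
    using tF(3) a(3) F fins by (simp add: sum.union_disjoint)
  also have "\<dots> = int (\<Sum>i\<in>F1 \<union> F2 \<union> F3. 1 + R * f i)" by (simp add: b_def)
  finally have "x = (\<Sum>i\<in>F1 \<union> F2 \<union> F3. 1 + R * f i)" by (simp only: of_nat_eq_iff)
  moreover have "F1 \<union> F2 \<union> F3 \<subseteq> B" using F tF J1 J2 by (auto simp: J3_def)
  ultimately show ?thesis by blast
qed

section \<open>Choice of the constants and the union bound\<close>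

text \<open>At most half of the n = 8 k steps can make progress: reaching \<theta> \<le> 2^k takes
  at most 3 k factors 3/2, and as M / \<theta> = 64 g R k is only linear in k, the late phase takes
  at most k steps.\<close>

lemma growth_potential_start_le:
  fixes g R y n k :: nat and \<eta> :: real
  assumes g: "g \<ge> 1" and R: "R \<ge> 1" and y: "2 * g \<le> y" "y = 2 ^ k" and n: "n = 8 * k" and k: "k \<ge> 1"
    and \<eta>: "\<eta> > 0" and large: "ln (64 * real g * real R * real k) / ln (1 + \<eta>) \<le> k"
  shows "growth_potential (y / (2 * g)) (4 * n * R * y) \<eta> 1 \<le> 4 * k"
proof -
  define \<theta> where "\<theta> = real y / (2 * g)"
  have "real (2 * g) \<le> real y" using y(1) by (simp only: of_nat_le_iff)
  then have \<theta>1: "1 \<le> \<theta>" "\<theta> \<le> real y" using g by (auto simp: \<theta>_def divide_simps mult_le_cancel_left1)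
  have ypos: "real y > 0" using y by simp
  have "ln (2/3 :: real) \<le> 2/3 - 1" by (rule ln_le_minus_one) simp
  then have D: "1/3 \<le> ln (3/2 :: real)" using ln_inverse[of "3/2 :: real"] by simp
  have "ln \<theta> \<le> ln (real y)" using \<theta>1 by simp
  also have "\<dots> = k * ln 2" by (simp add: y(2) ln_realpow)
  also have "\<dots> \<le> k" using ln_2_less_1 mult_left_mono[of "ln 2" 1 "real k"] by simp
  finally have "ln \<theta> / ln (3/2) \<le> k / ln (3/2)" using D by (intro divide_right_mono) auto
  also have "\<dots> \<le> k / (1/3)" using D by (intro divide_left_mono) auto
  finally have 1: "ln \<theta> / ln (3/2) \<le> 3 * k" by simp
  have "ln (4 * n * R * y) - ln \<theta> = ln (4 * n * R * y / \<theta>)"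
    using \<theta>1 ypos n k R by (subst ln_div) auto
  also have "4 * n * R * y / \<theta> = 64 * real g * real R * real k"
    using ypos g by (simp add: \<theta>_def n)
  finally have "growth_potential \<theta> (4 * n * R * y) \<eta> 1
      = ln \<theta> / ln (3/2) + ln (64 * real g * real R * real k) / ln (1 + \<eta>)"
    using \<theta>1 by (simp add: growth_potential_def)
  then show ?thesis using 1 large by (simp add: \<theta>_def)
qed

text \<open>With I the index set of a block and n = 8 k, a fixed J fails with probability at most
  2^n / g^(4 k) = 1 / 2^(card I + n), and there are at most 2^(card I) sets J.\<close>

lemma exists_good_blocks:
  fixes r :: nat
  assumes r: "r \<ge> 1"
  shows "\<exists>R k0. R \<ge> 1 \<and> k0 \<ge> 1 \<and> (\<forall>k\<ge>k0. \<exists>f :: nat \<Rightarrow> nat.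
    (\<forall>i<240 * r * k. f i \<in> {2 ^ k..<2 * 2 ^ k}) \<and>
    (\<forall>J\<subseteq>{..<240 * r * k}. card J = 8 * k \<longrightarrow> dense_window (8 * R * 2 ^ k) (sums_from R {0} f J)))"
proof -
  \<comment> \<open>Then g^(4 k) = 2^(240 r k + 16 k), which pays for all index sets; g and R = g!
    depend on r only.\<close>
  define g :: nat where "g = 4 ^ (30 * r + 2)"
  define R :: nat where "R = fact g"
  define \<eta> where "\<eta> = 1 / real (8 * (27 * R * g + 17))"
  have g: "g \<ge> 1" by (simp add: g_def)
  have R: "R \<ge> 1" by (simp add: R_def fact_ge_1)
  have \<eta>: "\<eta> > 0" unfolding \<eta>_def by (subst zero_less_divide_1_iff, subst of_nat_0_less_iff) simp
  have "\<forall>\<^sub>F k in sequentially. ln (c * real k) / e \<le> real k" if "c > 0" "e > 0" for c e :: real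
    using that by real_asymp
  from this[of "64 * real g * real R" "ln (1 + \<eta>)"]
  have "\<forall>\<^sub>F k in sequentially. ln (64 * real g * real R * real k) / ln (1 + \<eta>) \<le> real k"
    using g R \<eta> by simp
  moreover have "\<forall>\<^sub>F k in sequentially. g * (g + 1) \<le> k" by (rule eventually_ge_at_top)
  ultimately have "\<forall>\<^sub>F k in sequentially. ln (64 * real g * real R * real k) / ln (1 + \<eta>) \<le> real k \<and> g * (g + 1) \<le> k"
    by (rule eventually_conj)
  then obtain k1 where k1: "\<And>k. k \<ge> k1 \<Longrightarrow> ln (64 * real g * real R * real k) / ln (1 + \<eta>) \<le> real k \<and> g * (g + 1) \<le> k"
    by (auto simp: eventually_sequentially)
  have "\<exists>f :: nat \<Rightarrow> nat. (\<forall>i<240 * r * k. f i \<in> {2 ^ k..<2 * 2 ^ k}) \<and>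
    (\<forall>J\<subseteq>{..<240 * r * k}. card J = 8 * k \<longrightarrow> dense_window (8 * R * 2 ^ k) (sums_from R {0} f J))"
    if k: "k \<ge> max k1 1" for k
  proof (rule ccontr)
    define y :: nat where "y = 2 ^ k"
    define n where "n = 8 * k"
    define I where "I = {..<240 * r * k}"
    let ?X = "{y..<2 * y}"
    let ?bad = "\<lambda>f J. \<not> dense_window (8 * R * y) (sums_from R {0} f J)"
    assume none: "\<not> ?thesis"
    have kk: "k \<ge> 1" using k by simp
    have "k < y" unfolding y_def by (rule less_exp)
    moreover have "g * (g + 1) \<le> k" using k1 k by simp
    ultimately have yg: "g * (g + 1) \<le> y" by linarith
    have "g * 2 \<le> g * (g + 1)" using g by (intro mult_left_mono) auto
    then have y2g: "2 * g \<le> y" using yg by linarith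
    have cX: "card ?X = y" by simp
    have finI: "finite I" by (simp add: I_def)
    have cI: "card I = 30 * r * n" by (simp add: I_def n_def)
    have nN: "n \<le> card I" using r by (simp add: cI)
    have per: "real (card {f \<in> I \<rightarrow>\<^sub>E ?X. ?bad f J}) \<le> real y ^ card I / 2 ^ (card I + n)"
      if J: "J \<subseteq> I" "card J = n" for J
    proof -
      have finJ: "finite J" using J finI finite_subset by blast
      have "{f \<in> I \<rightarrow>\<^sub>E ?X. ?bad f J} = {f \<in> I \<rightarrow>\<^sub>E ?X. ?bad (restrict f J) J}"
        using sums_from_cong[of J "restrict _ J"] by (metis (no_types, lifting) restrict_apply')
      then have "card {f \<in> I \<rightarrow>\<^sub>E ?X. ?bad f J} \<le> card {f \<in> J \<rightarrow>\<^sub>E ?X. ?bad f J} * y ^ (card I - n)"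
        using card_PiE_restrict_le[OF finI J(1), of ?X "\<lambda>f. ?bad f J"] J by simp
      then have "real (card {f \<in> I \<rightarrow>\<^sub>E ?X. ?bad f J})
          \<le> real (card {f \<in> J \<rightarrow>\<^sub>E ?X. ?bad f J}) * real y ^ (card I - n)"
        by (simp flip: of_nat_mult of_nat_power)
      also have "\<dots> \<le> ((2 * y) ^ n * (1 / 2 ^ (card I + 2 * n))) * real y ^ (card I - n)"
      proof (rule mult_right_mono)
        let ?P = "growth_potential (y / (2 * g)) (4 * n * R * y) \<eta> 1"
        have "real (card {f \<in> J \<rightarrow>\<^sub>E ?X. ?bad f J}) \<le> (2 * y) ^ n * (1 / g) powr (n - ?P)"
          using card_bad_choices_block_le[OF g R_def yg _ \<eta>_def finJ J(2)] kk by (simp add: n_def)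
        also have "(1 / real g) powr (n - ?P) \<le> (1 / real g) powr (real (4 * k))"
        proof (rule powr_mono')
          have "?P \<le> 4 * k"
            using k1[of k] k by (intro growth_potential_start_le[OF g R y2g y_def n_def kk \<eta>]) auto
          then show "real (4 * k) \<le> n - ?P" by (simp add: n_def)
        qed (use g in auto)
        also have "(1 / real g) powr (real (4 * k)) = (1 / real g) ^ (4 * k)"
          using g by (intro powr_realpow) auto
        also have "\<dots> = 1 / 2 ^ (card I + 2 * n)"
        proof -
          have "g = 2 ^ (2 * (30 * r + 2))" unfolding g_def by (subst power_mult) simp
          then have "g ^ (4 * k) = 2 ^ (2 * (30 * r + 2) * (4 * k))" by (simp only: power_mult)
          also have "2 * (30 * r + 2) * (4 * k) = card I + 2 * n" by (simp add: cI n_def algebra_simps)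
          finally have "real (g ^ (4 * k)) = real (2 ^ (card I + 2 * n))" by (simp only:)
          then show ?thesis by (simp add: power_one_over)
        qed
        finally show "real (card {f \<in> J \<rightarrow>\<^sub>E ?X. ?bad f J}) \<le> (2 * y) ^ n * (1 / 2 ^ (card I + 2 * n))"
          by (simp add: mult_left_mono)
      qed simp
      also have "\<dots> = (real y ^ n * real y ^ (card I - n)) * (2 ^ n / 2 ^ (card I + 2 * n))"
        by (simp add: power_mult_distrib)
      also have "real y ^ n * real y ^ (card I - n) = real y ^ card I"
        using nN by (simp flip: power_add)
      also have "(2::real) ^ n / 2 ^ (card I + 2 * n) = 1 / 2 ^ (card I + n)"
        by (simp add: power_add mult_2)
      finally show ?thesis by simp
    qed
    have "I \<rightarrow>\<^sub>E ?X \<subseteq> (\<Union>J\<in>{J. J \<subseteq> I \<and> card J = n}. {f \<in> I \<rightarrow>\<^sub>E ?X. ?bad f J})"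
    proof
      fix f assume f: "f \<in> I \<rightarrow>\<^sub>E ?X"
      have "f i \<in> ?X" if "i < 240 * r * k" for i
        using PiE_mem[OF f, of i] that by (simp only: I_def lessThan_iff)
      then have "\<not> (\<forall>J\<subseteq>I. card J = n \<longrightarrow> \<not> ?bad f J)"
        using none unfolding I_def n_def y_def not_not by metis
      then obtain J where "J \<subseteq> I" "card J = n" "?bad f J" by metis
      then show "f \<in> (\<Union>J\<in>{J. J \<subseteq> I \<and> card J = n}. {f \<in> I \<rightarrow>\<^sub>E ?X. ?bad f J})" using f by blast
    qed
    moreover have finP: "finite (I \<rightarrow>\<^sub>E ?X)" using finI by (simp add: finite_PiE)
    ultimately have "card (I \<rightarrow>\<^sub>E ?X) \<le> card (\<Union>J\<in>{J. J \<subseteq> I \<and> card J = n}. {f \<in> I \<rightarrow>\<^sub>E ?X. ?bad f J})"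
      using finI by (intro card_mono) auto
    also have "\<dots> \<le> (\<Sum>J\<in>{J. J \<subseteq> I \<and> card J = n}. card {f \<in> I \<rightarrow>\<^sub>E ?X. ?bad f J})"
      using finI by (intro card_UN_le) auto
    finally have "y ^ card I \<le> (\<Sum>J\<in>{J. J \<subseteq> I \<and> card J = n}. card {f \<in> I \<rightarrow>\<^sub>E ?X. ?bad f J})"
      using finI by (simp add: card_PiE)
    then have "real (y ^ card I) \<le> real (\<Sum>J\<in>{J. J \<subseteq> I \<and> card J = n}. card {f \<in> I \<rightarrow>\<^sub>E ?X. ?bad f J})"
      by (simp only: of_nat_le_iff)
    also have "\<dots> = (\<Sum>J\<in>{J. J \<subseteq> I \<and> card J = n}. real (card {f \<in> I \<rightarrow>\<^sub>E ?X. ?bad f J}))"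
      by (rule of_nat_sum)
    also have "\<dots> \<le> (\<Sum>J\<in>{J. J \<subseteq> I \<and> card J = n}. real y ^ card I / 2 ^ (card I + n))"
      using per by (intro sum_mono) auto
    also have "\<dots> \<le> (\<Sum>J\<in>Pow I. real y ^ card I / 2 ^ (card I + n))"
      using finI by (intro sum_mono2) auto
    also have "\<dots> = real y ^ card I / 2 ^ n" using finI by (simp add: card_Pow power_add)
    also have "\<dots> < real y ^ card I"
    proof -
      have "(1::real) < 2 ^ n" using kk by (intro one_less_power) (auto simp: n_def)
      moreover have "0 < real y ^ card I" by (simp add: y_def)
      ultimately show ?thesis by (simp add: divide_less_eq)
    qed
    finally show False by simp
  qed
  then show ?thesis using R by (intro exI[of _ R] exI[of _ "max k1 1"]) auto
qed

section \<open>Assembling the blocks into one sequence\<close>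

text \<open>Take the largest k whose range starts at or below m. As (k + 1) 2^(k + 1) \<le> 4 k 2^k
  for k \<ge> 1, the ranges from 56 k R 2^k to 224 k R 2^k, which come from
  \<open>dense_blocks_cover_interval\<close> with n = 8 k, leave no gap.\<close>

lemma exists_scale:
  fixes R k0 m :: nat
  assumes R: "R \<ge> 1" and k0: "k0 \<ge> 1" and m: "56 * k0 * R * 2 ^ k0 \<le> m"
  shows "\<exists>k\<ge>k0. 56 * k * R * 2 ^ k \<le> m \<and> m \<le> 224 * k * R * 2 ^ k"
proof -
  let ?P = "\<lambda>k. k0 \<le> k \<and> 56 * k * R * 2 ^ k \<le> m"
  have bound: "k \<le> m" if "?P k" for k
  proof -
    have "k * 1 \<le> k * (56 * R * 2 ^ k)" using R by (intro mult_left_mono) auto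
    moreover have "k * (56 * R * 2 ^ k) = 56 * k * R * 2 ^ k" by simp
    ultimately show ?thesis using that by linarith
  qed
  define k where "k = (GREATEST k. ?P k)"
  have k: "?P k" unfolding k_def
  proof (rule GreatestI_nat)
    show "?P k0" using m by simp
  qed (rule bound)
  have "\<not> ?P (Suc k)"
  proof
    assume "?P (Suc k)"
    then have "Suc k \<le> k" unfolding k_def by (rule Greatest_le_nat) (rule bound)
    then show False by simp
  qed
  then have "m < 56 * Suc k * R * 2 ^ Suc k" using k by auto
  also have "\<dots> = 112 * Suc k * (R * 2 ^ k)" by simp
  also have "\<dots> \<le> 224 * k * (R * 2 ^ k)" using k k0 by (intro mult_right_mono) auto
  finally show ?thesis using k by (intro exI[of _ k]) (auto simp: mult.assoc)
qed

lemma exists_sparse_ramsey_complete: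
  fixes r :: nat
  assumes r: "r \<ge> 1"
  shows "\<exists>a :: nat \<Rightarrow> nat. (\<forall>i. a i > 0) \<and> ramsey_complete r a \<and>
    (\<forall>n\<ge>1. finite (counting a n) \<and> real (card (counting a n)) \<le> 960 * real r * (ln (real n))\<^sup>2)"
proof -
  obtain R k0 where R: "R \<ge> 1" and k0: "k0 \<ge> 1" and "\<forall>k\<ge>k0. \<exists>f :: nat \<Rightarrow> nat.
    (\<forall>i<240 * r * k. f i \<in> {2 ^ k..<2 * 2 ^ k}) \<and>
    (\<forall>J\<subseteq>{..<240 * r * k}. card J = 8 * k \<longrightarrow> dense_window (8 * R * 2 ^ k) (sums_from R {0} f J))"
    using exists_good_blocks[OF r] by blast
  then obtain f :: "nat \<Rightarrow> nat \<Rightarrow> nat"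
    where f: "\<And>k i. k \<ge> k0 \<Longrightarrow> i < 240 * r * k \<Longrightarrow> f k i \<in> {2 ^ k..<2 * 2 ^ k}"
      and dense: "\<And>k J. k \<ge> k0 \<Longrightarrow> J \<subseteq> {..<240 * r * k} \<Longrightarrow> card J = 8 * k \<Longrightarrow>
        dense_window (8 * R * 2 ^ k) (sums_from R {0} (f k) J)"
    by metis
  \<comment> \<open>The pairs (block, position in the block), to be enumerated by h as a single
    sequence.\<close>
  define X where "X = (SIGMA k:{k0..}. {..<240 * r * k})"
  have "(\<lambda>k. (k, 0)) ` {k0..} \<subseteq> X" using r k0 by (auto simp: X_def)
  moreover have "infinite ((\<lambda>k. (k, 0::nat)) ` {k0..})"
    by (subst finite_image_iff) (auto simp: inj_on_def infinite_Ici)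
  ultimately have "infinite X" using finite_subset by blast
  then have bij: "bij_betw (from_nat_into X) UNIV X" by (intro bij_betw_from_nat_into) auto
  define h where "h = from_nat_into X"
  have h: "inj h" "range h = X" using bij by (auto simp: h_def bij_betw_def)
  have hX: "h j \<in> X" for j using h(2) by blast
  define a where "a j = 1 + R * f (fst (h j)) (snd (h j))" for j
  have complete: "ramsey_complete r a"
    unfolding ramsey_complete_def
  \<comment> \<open>The threshold is the same for all colourings: it is where the range of the first
    block starts.\<close>
  proof (intro allI impI, rule exI[of _ "56 * k0 * R * 2 ^ k0"], intro allI impI)
    fix col :: "nat \<Rightarrow> nat" and m
    assume col: "\<forall>i. col i < r" and "56 * k0 * R * 2 ^ k0 \<le> m"
    then obtain k where k: "k \<ge> k0" "56 * k * R * 2 ^ k \<le> m" "m \<le> 224 * k * R * 2 ^ k"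
      using exists_scale[OF R k0] by blast
    define e where "e i = inv h (k, i)" for i
    have he: "h (e i) = (k, i)" if "i < 240 * r * k" for i
      unfolding e_def using that k h(2) by (intro f_inv_into_f) (auto simp: X_def)
    let ?I = "{..<240 * r * k}"
    define B where "B j = {i \<in> ?I. col (e i) = j}" for j
    have "\<exists>j<r. 240 * k \<le> card (B j)"
    proof (rule ccontr)
      assume "\<not> ?thesis"
      then have "(\<Sum>j<r. card (B j)) < (\<Sum>j<r. 240 * k)"
        using r by (intro sum_strict_mono) (auto simp: lessThan_empty_iff)
      moreover have "(\<Sum>j<r. \<Sum>i\<in>B j. 1) = (\<Sum>i\<in>?I. 1 :: nat)"
        unfolding B_def using col by (intro sum.group) auto
      ultimately show False by simp
    qed
    then obtain j where j: "j < r" "240 * k \<le> card (B j)" by blast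
    have BI: "B j \<subseteq> ?I" by (auto simp: B_def)
    have "\<exists>F\<subseteq>B j. m = (\<Sum>i\<in>F. 1 + R * f k i)"
    proof (rule dense_blocks_cover_interval[where n = "8 * k" and y = "2 ^ k"])
      show "f k i \<in> {2 ^ k..<2 * 2 ^ k}" if "i \<in> B j" for i
        using that BI by (intro f[OF k(1)]) auto
      show "dense_window (8 * R * 2 ^ k) (sums_from R {0} (f k) J)" if "J \<subseteq> B j" "card J = 8 * k" for J
        using that BI by (intro dense[OF k(1)]) auto
      show "finite (B j)" by (simp add: B_def)
      show "30 * (8 * k) \<le> card (B j)" using j by simp
      show "7 * (8 * k) * R * 2 ^ k \<le> m" "m \<le> 28 * (8 * k) * R * 2 ^ k" using k by simp_all
    qed (use R k k0 in auto)
    then obtain F where F: "F \<subseteq> B j" "m = (\<Sum>i\<in>F. 1 + R * f k i)" by blast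
    have finF: "finite F" using F by (auto simp: B_def intro: finite_subset)
    have heF: "h (e i) = (k, i)" if "i \<in> F" for i using that F BI by (intro he) auto
    have "inj_on e F" using heF by (metis inj_onI prod.inject)
    then have "sum a (e ` F) = (\<Sum>i\<in>F. a (e i))" by (simp add: sum.reindex)
    also have "\<dots> = m" unfolding F(2) using heF by (intro sum.cong) (auto simp: a_def)
    finally have "m = sum a (e ` F)" by simp
    moreover have "e ` F \<subseteq> {i. col i = j}" using F by (auto simp: B_def)
    ultimately have "m \<in> subset_sums a {i. col i = j}" using finF unfolding subset_sums_def by blast
    then show "\<exists>j<r. m \<in> subset_sums a {i. col i = j}" using j by blast
  qed
  have count: "finite (counting a n) \<and> real (card (counting a n)) \<le> 960 * real r * (ln (real n))\<^sup>2"
    if n: "n \<ge> 1" for n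
  proof -
    \<comment> \<open>Terms of block k exceed 2^k, so only blocks k \<le> L contribute, with at most
      240 r L^2 terms; L \<le> 2 ln n turns 240 into 960.\<close>
    define L where "L = nat \<lfloor>log 2 (real n)\<rfloor>"
    let ?Y = "SIGMA k:{1..L}. {..<240 * r * k}"
    have sub: "h ` counting a n \<subseteq> ?Y"
    proof (rule image_subsetI)
      fix j assume j: "j \<in> counting a n"
      obtain k i where ki: "h j = (k, i)" by (cases "h j")
      have kX: "k0 \<le> k" "i < 240 * r * k" using hX[of j] ki by (auto simp: X_def)
      have "2 ^ k \<le> f k i" using f[OF kX] by simp
      also have "\<dots> \<le> R * f k i" using R by simp
      also have "\<dots> \<le> n" using j ki by (simp add: counting_def a_def)
      finally have "real (2 ^ k) \<le> real n" by (simp only: of_nat_le_iff)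
      then have "real k \<le> log 2 (real n)" using n by (simp add: le_log_iff powr_realpow)
      then have "k \<le> L" unfolding L_def by linarith
      then show "h j \<in> ?Y" using ki kX k0 by auto
    qed
    have inj: "inj_on h (counting a n)" using h(1) by (rule inj_on_subset) simp
    have "finite (h ` counting a n)" using sub by (rule finite_subset) auto
    then have fin: "finite (counting a n)" using inj by (rule finite_imageD)
    have "card (counting a n) = card (h ` counting a n)" using inj by (simp add: card_image)
    also have "\<dots> \<le> card ?Y" using sub by (intro card_mono) auto
    also have "\<dots> = (\<Sum>k=1..L. 240 * r * k)" by simp
    also have "\<dots> \<le> (\<Sum>k=1..L. 240 * r * L)" by (intro sum_mono mult_left_mono) auto
    also have "\<dots> = 240 * r * L\<^sup>2" by (simp add: power2_eq_square)
    finally have "real (card (counting a n)) \<le> real (240 * r * L\<^sup>2)" by (simp only: of_nat_le_iff)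
    also have "\<dots> = 240 * real r * (real L)\<^sup>2" by simp
    also have "\<dots> \<le> 240 * real r * (2 * ln (real n))\<^sup>2"
    proof (intro mult_left_mono power_mono)
      have ln0: "0 \<le> ln (real n)" using n by simp
      have "real L \<le> log 2 (real n)" unfolding L_def using n by (intro of_nat_floor) simp
      also have "\<dots> = ln (real n) / ln 2" by (simp add: log_def)
      also have "\<dots> \<le> ln (real n) / (1/2)" using ln_2_ge_half ln0 by (intro divide_left_mono) auto
      finally show "real L \<le> 2 * ln (real n)" by simp
    qed auto
    also have "\<dots> = 960 * real r * (ln (real n))\<^sup>2" by (simp add: power_mult_distrib)
    finally show ?thesis using fin by blast
  qed
  have "\<forall>i. a i > 0" by (simp add: a_def)
  with complete count show ?thesis by blast
qed

theorem theorem1p1: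
  shows "(\<exists>C::real. \<forall>r::nat. r \<ge> 2 \<longrightarrow>
            (\<exists>a :: nat \<Rightarrow> nat. (\<forall>i. a i > 0) \<and> ramsey_complete r a \<and>
               (\<forall>n::nat. n \<ge> 1 \<longrightarrow> finite (counting a n) \<and>
                   real (card (counting a n)) \<le> C * real r * (ln (real n))\<^sup>2)))
       \<and> (\<exists>c::real. c > 0 \<and> (\<forall>r::nat. r \<ge> 2 \<longrightarrow>
            (\<forall>a :: nat \<Rightarrow> nat. (\<forall>i. a i > 0) \<longrightarrow>
               (\<forall>\<^sub>F n in sequentially. finite (counting a n) \<and>
                   real (card (counting a n)) \<le> c * real r * (ln (real n))\<^sup>2) \<longrightarrow>
               \<not> ramsey_complete r a)))"
proof (rule conjI)
  show "\<exists>C::real. \<forall>r::nat. r \<ge> 2 \<longrightarrow>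
      (\<exists>a :: nat \<Rightarrow> nat. (\<forall>i. a i > 0) \<and> ramsey_complete r a \<and>
         (\<forall>n::nat. n \<ge> 1 \<longrightarrow> finite (counting a n) \<and>
             real (card (counting a n)) \<le> C * real r * (ln (real n))\<^sup>2))"
    by (intro exI[of _ 960] allI impI exists_sparse_ramsey_complete) simp
next
  have "\<not> ramsey_complete r a"
    if r: "r \<ge> 2" and pos: "\<forall>i. a i > 0"
      and bnd: "\<forall>\<^sub>F n in sequentially. finite (counting a n) \<and>
        real (card (counting a n)) \<le> 1/2880 * real r * (ln (real n))\<^sup>2"
    for r :: nat and a :: "nat \<Rightarrow> nat"
  proof -
    \<comment> \<open>Finiteness for large n gives finiteness for every n, since
      \<open>counting a n\<close> grows with n.\<close>
    obtain N where N: "\<And>n. n \<ge> N \<Longrightarrow> finite (counting a n)"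
      using bnd by (auto simp: eventually_sequentially)
    have "finite (counting a n)" for n
      using N[of "max n N"] by (rule finite_subset[rotated]) (auto simp: counting_def)
    moreover have "\<forall>\<^sub>F n in sequentially. real (card (counting a n)) \<le> 1/2880 * real r * (ln (real n))\<^sup>2"
      using bnd by eventually_elim simp
    ultimately show ?thesis using pos r by (intro sparse_not_ramsey_complete) auto
  qed
  then show "\<exists>c::real. c > 0 \<and> (\<forall>r::nat. r \<ge> 2 \<longrightarrow>
      (\<forall>a :: nat \<Rightarrow> nat. (\<forall>i. a i > 0) \<longrightarrow>
         (\<forall>\<^sub>F n in sequentially. finite (counting a n) \<and>
             real (card (counting a n)) \<le> c * real r * (ln (real n))\<^sup>2) \<longrightarrow>
         \<not> ramsey_complete r a))"
    by (intro exI[of _ "1/2880"]) simp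
qed

end
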